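(* Let $(g,c,n)$ be a v-admissible triplet of integers with $5\le g\le c\le n$. (i) If $c<3g-4$, then $g/4\le A(g,c,n)\le (2g-1)/4$. (ii) If $c=3g-4$, then $g/4\le A(g,c,n)\le (g+2)/4$ when $g$ is even, and $g/4\le A(g,c,n)\le (g+3)/4$ when $g$ is odd. (iii) If $c>3g-4$, then $g/4\le A(g,c,n)\le (3g+5)/8$ when $g$ is even, and $g/4\le A(g,c,n)\le (3g+7)/8$ when $g$ is odd.
   Context: All graphs are finite, simple and connected. A graph $G$ is regarded as a geodesic metric space by identifying each edge isometrically with $[0,1]$; points are vertices and interior points of edges, $d$ is the shortest-path length. A geodesic triangle $T=\{x,y,z\}$ is a union of three geodesics $[xy],[yz],[zx]$; $\delta(T)$ is the infimum of $\delta\ge0$ such that each side lies in the $\delta$-neighbourhood of the union of the other two; $\delta(G)=\sup_T\delta(T)$ over geodesic triangles. Girth $g(G)$ / circumference $c(G)$: length of a shortest / longest cycle. $\mathcal{G}(g,c,n)$ is the set of graphs with girth $g$, circumference $c$ and $n$ vertices, and $A(g,c,n)=\min\{\delta(G):G\in\mathcal{G}(g,c,n)\}$. A triplet $(g,c,n)$ is v-admissible if $\mathcal{G}(g,c,n)\ne\emptyset$. *)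

theory Defs
  imports Complex_Main
begin

section \<open>Finite simple connected graphs\<close>

definition simple_graph :: "'a set \<Rightarrow> 'a set set \<Rightarrow> bool" where
  "simple_graph V E \<longleftrightarrow> finite V \<and> (\<forall>e\<in>E. e \<subseteq> V \<and> card e = 2)"

definition connected_graph :: "'a set \<Rightarrow> 'a set set \<Rightarrow> bool" where
  "connected_graph V E \<longleftrightarrow>
     V \<noteq> {} \<and> (\<forall>u\<in>V. \<forall>v\<in>V. (u, v) \<in> {(a, b). {a, b} \<in> E}\<^sup>*)"

definition graph_cycle :: "'a set set \<Rightarrow> 'a list \<Rightarrow> bool" where
  "graph_cycle E p \<longleftrightarrow>
     3 \<le> length p \<and> distinct p \<and>
     (\<forall>i<length p. {p ! i, p ! (Suc i mod length p)} \<in> E)"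

definition cycle_lengths :: "'a set set \<Rightarrow> nat set" where
  "cycle_lengths E = {length p | p. graph_cycle E p}"

text \<open>Both are meaningful only for a finite graph with at least one cycle.\<close>

definition girth :: "'a set set \<Rightarrow> nat" where
  "girth E = Min (cycle_lengths E)"

definition circumference :: "'a set set \<Rightarrow> nat" where
  "circumference E = Max (cycle_lengths E)"


section \<open>The graph as a metric space\<close>

text \<open>
  A point is given by its barycentric coordinates: \<open>edge_point u v t\<close> is the point
  at distance \<open>t\<close> from \<open>u\<close> on the edge \<open>{u, v}\<close>, and the vertex \<open>u\<close> is
  \<open>edge_point u v 0\<close>. With this encoding the ends of edges meeting at a vertex are
  the same point, and \<open>edge_point u v t = edge_point v u (1 - t)\<close> for \<open>u \<noteq> v\<close>.
\<close>

definition vertex_point :: "'a \<Rightarrow> ('a \<Rightarrow> real)" where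
  "vertex_point u = (\<lambda>w. if w = u then 1 else 0)"

definition edge_point :: "'a \<Rightarrow> 'a \<Rightarrow> real \<Rightarrow> ('a \<Rightarrow> real)" where
  "edge_point u v t = (\<lambda>w. if w = u then 1 - t else if w = v then t else 0)"

definition graph_points :: "'a set \<Rightarrow> 'a set set \<Rightarrow> ('a \<Rightarrow> real) set" where
  "graph_points V E =
     vertex_point ` V \<union> {edge_point u v t | u v t. {u, v} \<in> E \<and> 0 \<le> t \<and> t \<le> 1}"

text \<open>
  \<open>path_length E x y l\<close>: some path from \<open>x\<close> to \<open>y\<close>, made of finitely many segments
  each inside one closed edge, has length \<open>l\<close>.
\<close>

inductive path_length :: "'a set set \<Rightarrow> ('a \<Rightarrow> real) \<Rightarrow> ('a \<Rightarrow> real) \<Rightarrow> real \<Rightarrow> bool"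
  for E and x where
  refl: "path_length E x x 0"
| step: "path_length E x (edge_point u v s) l \<Longrightarrow> {u, v} \<in> E \<Longrightarrow>
         0 \<le> s \<Longrightarrow> s \<le> 1 \<Longrightarrow> 0 \<le> t \<Longrightarrow> t \<le> 1 \<Longrightarrow>
         path_length E x (edge_point u v t) (l + \<bar>s - t\<bar>)"

definition graph_dist :: "'a set set \<Rightarrow> ('a \<Rightarrow> real) \<Rightarrow> ('a \<Rightarrow> real) \<Rightarrow> real" where
  "graph_dist E x y = Inf {l. path_length E x y l}"


section \<open>Geodesic triangles and the hyperbolicity constant\<close>

text \<open>\<open>geodesic V E x y S\<close>: the set \<open>S\<close> is (the image of) a geodesic from \<open>x\<close> to \<open>y\<close>.\<close>

definition geodesic ::
    "'a set \<Rightarrow> 'a set set \<Rightarrow> ('a \<Rightarrow> real) \<Rightarrow> ('a \<Rightarrow> real) \<Rightarrow> ('a \<Rightarrow> real) set \<Rightarrow> bool" where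
  "geodesic V E x y S \<longleftrightarrow>
     (\<exists>\<gamma>. \<gamma> ` {0..graph_dist E x y} = S \<and> S \<subseteq> graph_points V E \<and>
          \<gamma> 0 = x \<and> \<gamma> (graph_dist E x y) = y \<and>
          (\<forall>s\<in>{0..graph_dist E x y}. \<forall>t\<in>{0..graph_dist E x y}.
             graph_dist E (\<gamma> s) (\<gamma> t) = \<bar>s - t\<bar>))"

text \<open>A triangle is recorded by its three sides; vertices and sides may be degenerate.\<close>

definition geodesic_triangle ::
    "'a set \<Rightarrow> 'a set set \<Rightarrow>
     ('a \<Rightarrow> real) set \<times> ('a \<Rightarrow> real) set \<times> ('a \<Rightarrow> real) set \<Rightarrow> bool" where
  "geodesic_triangle V E T \<longleftrightarrow>
     (case T of (A, B, C) \<Rightarrow>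
        \<exists>x\<in>graph_points V E. \<exists>y\<in>graph_points V E. \<exists>z\<in>graph_points V E.
          geodesic V E x y A \<and> geodesic V E y z B \<and> geodesic V E z x C)"

definition in_nbhd ::
    "'a set set \<Rightarrow> real \<Rightarrow> ('a \<Rightarrow> real) set \<Rightarrow> ('a \<Rightarrow> real) set \<Rightarrow> bool" where
  "in_nbhd E r S U \<longleftrightarrow> (\<forall>p\<in>S. \<exists>q\<in>U. graph_dist E p q \<le> r)"

definition triangle_delta ::
    "'a set set \<Rightarrow> ('a \<Rightarrow> real) set \<times> ('a \<Rightarrow> real) set \<times> ('a \<Rightarrow> real) set \<Rightarrow> real" where
  "triangle_delta E T =
     (case T of (A, B, C) \<Rightarrow>
        Inf {r. 0 \<le> r \<and> in_nbhd E r A (B \<union> C) \<and> in_nbhd E r B (C \<union> A) \<and>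
                in_nbhd E r C (A \<union> B)})"

text \<open>
  The supremum is taken in the reals: a finite connected graph has finite diameter, which
  bounds every \<open>triangle_delta E T\<close>.
\<close>

definition hyp_const :: "'a set \<Rightarrow> 'a set set \<Rightarrow> real" where
  "hyp_const V E = Sup {triangle_delta E T | T. geodesic_triangle V E T}"


section \<open>Graphs with given girth, circumference and order\<close>

text \<open>
  Graphs with \<open>n\<close> vertices are taken with vertex set \<open>{..<n}\<close>, one labelled representative
  of each isomorphism class at least; such a graph is given by its edge set. Forests, which
  have neither a (finite) girth nor a circumference, are excluded.
\<close>

definition graph_class :: "nat \<Rightarrow> nat \<Rightarrow> nat \<Rightarrow> nat set set set" where
  "graph_class g c n =
     {E. simple_graph {..<n} E \<and> connected_graph {..<n} E \<and> cycle_lengths E \<noteq> {} \<and>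
         girth E = g \<and> circumference E = c}"

definition v_admissible :: "nat \<Rightarrow> nat \<Rightarrow> nat \<Rightarrow> bool" where
  "v_admissible g c n \<longleftrightarrow> graph_class g c n \<noteq> {}"

text \<open>So the minimum below is over a finite set, nonempty when \<open>v_admissible g c n\<close>.\<close>

lemma finite_graph_class: "finite (graph_class g c n)"
  by (rule finite_subset[of _ "Pow (Pow {..<n})"])
     (auto simp: graph_class_def simple_graph_def)

definition min_hyp_const :: "nat \<Rightarrow> nat \<Rightarrow> nat \<Rightarrow> real" where
  "min_hyp_const g c n = Min (hyp_const {..<n} ` graph_class g c n)"

end

theory Submission
  imports Defs
begin

text \<open>
  Lower bound: a shortest cycle is isometrically embedded, since a shortcut would close a shorter
  cycle; two antipodal points split it into two geodesics, and the midpoint of either is at distance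
  \<open>g / 4\<close> from the other.

  Upper bound: let \<open>p\<close> on one side of a geodesic triangle be at distance more than \<open>D\<close> from the
  other two sides. Going around the triangle joins the two points of that side at distance \<open>D\<close>
  from \<open>p\<close> outside the \<open>D\<close>-ball around \<open>p\<close>, so the geodesic arc between them closes to a cycle all
  of whose other vertices are at distance at least \<open>D\<close> from \<open>p\<close>; we call such a cycle tight. As the arc
  is geodesic, the cycle has length at least \<open>4 D\<close>, which gives \<open>\<delta>(G) \<le> c / 4\<close> and settles
  \<open>c < 2 g\<close> without any knowledge of which triplets are v-admissible.

  For \<open>c \<ge> 2 g\<close> take a Hamiltonian cycle on \<open>c\<close> vertices, all of whose chords share a vertex
  (the apex), and hang the other \<open>n - c\<close> vertices on the apex. The chords cut the cycle into cells;
  if these have length at most \<open>M\<close> then the two shortcuts along the cell of \<open>p\<close> exclude tight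
  cycles with \<open>4 D > M + 2\<close>. One cell has length \<open>g\<close>. For \<open>c < 3 g - 4\<close> there is one more cell;
  otherwise the remainder of \<open>c - 2\<close> modulo \<open>g - 2\<close> is shared by the last two cells.
\<close>

text \<open>Two gaps separate the metric definitions from statements about vertices. A distance is
  an infimum over paths, and a side of a triangle is an arbitrary isometric image, not a priori an
  edge path. Straightening paths makes the infimum a minimum and turns the arc of length
  \<open>2 * D\<close> around \<open>p\<close> into a vertex walk. The route around the triangle
  needs less: it is broken into jumps inside single edges, at levels \<open>r < D\<close>, because
  the paths that replace pieces of a geodesic may dip slightly into the ball. As there are finitely
  many vertices, for \<open>r\<close> close to \<open>D\<close> every vertex farther than
  \<open>r\<close> is already at distance at least \<open>D\<close>. The 2 in \<open>M + 2\<close>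
  arises when just one end \<open>i\<close> of the cell of \<open>p\<close> lies on the geodesic
  arc. With a shortcut of length \<open>q\<close> from \<open>i\<close> to \<open>j\<close>, the arc
  being geodesic gives \<open>t + D - i <= q + j - (t + D)\<close>, and a far vertex one step away
  from \<open>i\<close> gives \<open>D <= t - i + 1\<close>. The first plus twice the second is
  \<open>4 * D <= (j - i + q) + 2\<close>, where \<open>j - i + q\<close> is the length of the cell.
  The hypothesis \<open>5 <= g\<close> gives every cell at least three path edges, so that the two
  edges over the apex are a genuine shortcut.\<close>

abbreviation adj :: "'a set set \<Rightarrow> ('a \<times> 'a) set" where
  "adj E \<equiv> {(a, b). {a, b} \<in> E}"

section \<open>Distances between points of a graph\<close>

lemma edge_point_0 [simp]: "edge_point u v 0 = vertex_point u"
  by (auto simp: edge_point_def vertex_point_def)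

lemma edge_point_1: "u \<noteq> v \<Longrightarrow> edge_point u v 1 = vertex_point v"
  by (auto simp: edge_point_def vertex_point_def)

lemma edge_point_swap: "u \<noteq> v \<Longrightarrow> edge_point u v t = edge_point v u (1 - t)"
  by (auto simp: edge_point_def)

lemma edge_point_first [simp]: "edge_point u v t u = 1 - t"
  by (simp add: edge_point_def)

lemma edge_point_second: "u \<noteq> v \<Longrightarrow> edge_point u v t v = t"
  by (simp add: edge_point_def)

lemma edge_point_pos_iff:
  "0 < edge_point u v t a \<Longrightarrow> a = u \<or> a = v"
  by (auto simp: edge_point_def split: if_splits)

lemma vertex_point_self [simp]: "vertex_point u u = 1"
  by (simp add: vertex_point_def)

lemma vertex_point_pos_iff [simp]: "0 < vertex_point u a \<longleftrightarrow> a = u"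
  by (simp add: vertex_point_def)

lemma path_length_trans:
  assumes "path_length E y z l'" "path_length E x y l"
  shows "path_length E x z (l + l')"
  using assms
proof (induction)
  case refl
  then show ?case by simp
next
  case (step u v s l'' t)
  then have "path_length E x (edge_point u v t) ((l + l'') + \<bar>s - t\<bar>)"
    by (intro path_length.step) auto
  then show ?case by (simp add: add.assoc)
qed

lemma path_length_edge:
  assumes "{u, v} \<in> E" "0 \<le> s" "s \<le> 1" "0 \<le> t" "t \<le> 1"
  shows "path_length E (edge_point u v s) (edge_point u v t) \<bar>s - t\<bar>"
  using path_length.step[OF path_length.refl assms] by simp

lemma path_length_sym:
  assumes "path_length E x y l"
  shows "path_length E y x l"
  using assms
proof (induction)
  case refl
  then show ?case by (rule path_length.refl)
next
  case (step u v s l t)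
  have "path_length E (edge_point u v t) (edge_point u v s) \<bar>t - s\<bar>"
    using step by (intro path_length_edge)
  from path_length_trans[OF step.IH this] show ?case
    by (simp add: abs_minus_commute add.commute)
qed

lemma path_length_nonneg: "path_length E x y l \<Longrightarrow> 0 \<le> l"
  by (induction rule: path_length.induct) auto

lemma graph_dist_le: "path_length E x y l \<Longrightarrow> graph_dist E x y \<le> l"
  unfolding graph_dist_def
  by (rule cInf_lower) (auto intro!: bdd_belowI[of _ 0] dest: path_length_nonneg)

lemma graph_dist_sym: "graph_dist E x y = graph_dist E y x"
  unfolding graph_dist_def by (rule arg_cong[where f = Inf]) (auto intro: path_length_sym)

lemma graph_dist_self [simp]: "graph_dist E x x = 0"
proof (rule antisym)
  show "graph_dist E x x \<le> 0" by (rule graph_dist_le) (rule path_length.refl)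
  show "0 \<le> graph_dist E x x"
    unfolding graph_dist_def
    by (rule cInf_greatest) (auto intro: path_length.refl path_length_nonneg)
qed

locale metric_graph =
  fixes V :: "'a set" and E :: "'a set set"
  assumes simple: "simple_graph V E" and connected: "connected_graph V E"
begin

abbreviation pts :: "('a \<Rightarrow> real) set" where "pts \<equiv> graph_points V E"

abbreviation gdist :: "('a \<Rightarrow> real) \<Rightarrow> ('a \<Rightarrow> real) \<Rightarrow> real" where
  "gdist \<equiv> graph_dist E"

lemma finite_V: "finite V"
  using simple by (simp add: simple_graph_def)

lemma edge_neq: "{u, v} \<in> E \<Longrightarrow> u \<noteq> v"
  using simple by (fastforce simp: simple_graph_def)

lemma edge_in_V: "{u, v} \<in> E \<Longrightarrow> u \<in> V \<and> v \<in> V"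
  using simple by (fastforce simp: simple_graph_def)

lemma vertex_in_pts: "u \<in> V \<Longrightarrow> vertex_point u \<in> pts"
  by (simp add: graph_points_def)

lemma edge_point_in_pts: "{u, v} \<in> E \<Longrightarrow> 0 \<le> t \<Longrightarrow> t \<le> 1 \<Longrightarrow> edge_point u v t \<in> pts"
  by (auto simp: graph_points_def)

lemma pts_cases:
  assumes "x \<in> pts"
  obtains (vertex) u where "u \<in> V" "x = vertex_point u"
  | (edge) u v t where "{u, v} \<in> E" "0 < t" "t < 1" "x = edge_point u v t"
proof -
  from assms consider u where "u \<in> V" "x = vertex_point u"
    | u v t where "{u, v} \<in> E" "0 \<le> t" "t \<le> 1" "x = edge_point u v t"
    by (auto simp: graph_points_def)
  then show ?thesis
  proof cases
    case 2
    show ?thesis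
    proof (cases "t = 0 \<or> t = 1")
      case True
      then have "x = vertex_point u \<or> x = vertex_point v"
        using 2 edge_point_1[of u v] edge_neq[of u v] by auto
      then show ?thesis using vertex edge_in_V 2 by blast
    next
      case False
      then show ?thesis using edge[of u v t] 2 by simp
    qed
  qed (use vertex in blast)
qed

lemma path_length_in_pts: "path_length E x y l \<Longrightarrow> x \<in> pts \<Longrightarrow> y \<in> pts"
  by (induction rule: path_length.induct) (auto intro: edge_point_in_pts)

lemma pts_pos:
  assumes "x \<in> pts"
  obtains u where "u \<in> V" "0 < x u"
  using assms
proof (cases rule: pts_cases)
  case (edge u v t)
  then show ?thesis using that[of u] edge_in_V by auto
qed (use that in auto)

lemma pts_pos_in_V: "x \<in> pts \<Longrightarrow> 0 < x u \<Longrightarrow> u \<in> V"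
  by (cases rule: pts_cases) (auto dest: edge_point_pos_iff edge_in_V)

lemma pts_le_1: "x \<in> pts \<Longrightarrow> x u \<le> 1"
  by (cases rule: pts_cases) (auto simp: vertex_point_def edge_point_def)

text \<open>In barycentric coordinates a positive \<open>x a\<close> marks \<open>a\<close> as an
  end of an edge carrying \<open>x\<close>, and \<open>1 - x a\<close> is the length of the segment
  between them. All later statements address the ends of an edge in this way.\<close>

lemma path_length_to_vertex:
  assumes "x \<in> pts" "0 < x a"
  shows "path_length E x (vertex_point a) (1 - x a)"
  using assms(1)
proof (cases rule: pts_cases)
  case (vertex u)
  then show ?thesis using assms by (auto intro: path_length.refl)
next
  case (edge u v t)
  then have "a = u \<or> a = v" using assms(2) by (auto dest: edge_point_pos_iff)
  then show ?thesis
  proof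
    assume "a = u"
    then show ?thesis using path_length_edge[of u v E t 0] edge by simp
  next
    assume "a = v"
    then show ?thesis
      using path_length_edge[of u v E t 1] edge edge_neq[of u v] edge_point_1[of u v] edge_point_second[of u v]
      by simp
  qed
qed

lemma path_length_relpow:
  "(u, v) \<in> adj E ^^ n \<Longrightarrow> path_length E (vertex_point u) (vertex_point v) (real n)"
proof (induction n arbitrary: v)
  case 0
  then show ?case by (auto intro: path_length.refl)
next
  case (Suc n)
  then obtain b where b: "(u, b) \<in> adj E ^^ n" "{b, v} \<in> E" by auto
  have "path_length E (vertex_point b) (vertex_point v) 1"
    using path_length_edge[of b v E 0 1] b edge_neq[of b v] edge_point_1[of b v] by simp
  from path_length_trans[OF this Suc.IH[OF b(1)]] show ?case by (simp add: add.commute)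
qed

lemma path_length_walk:
  assumes "x \<in> pts" "y \<in> pts" "0 < x u" "0 < y v" "(u, v) \<in> adj E ^^ n"
  shows "path_length E x y ((1 - x u) + real n + (1 - y v))"
  using path_length_trans[OF path_length_sym[OF path_length_to_vertex[OF assms(2,4)]]
      path_length_trans[OF path_length_relpow[OF assms(5)] path_length_to_vertex[OF assms(1,3)]]]
  by simp

lemma path_length_exists:
  assumes "x \<in> pts" "y \<in> pts"
  shows "\<exists>l. path_length E x y l"
proof -
  obtain u v where "u \<in> V" "0 < x u" "v \<in> V" "0 < y v"
    using pts_pos assms by metis
  moreover from this obtain n where "(u, v) \<in> adj E ^^ n"
    using connected rtrancl_imp_relpow unfolding connected_graph_def by blast
  ultimately show ?thesis using path_length_walk assms by blast
qed

lemma graph_dist_less_path: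
  assumes "x \<in> pts" "y \<in> pts" "gdist x y < r"
  shows "\<exists>l. path_length E x y l \<and> l < r"
proof -
  have "{l. path_length E x y l} \<noteq> {}" using path_length_exists assms by simp
  from cInf_lessD[OF this] show ?thesis
    using assms(3) unfolding graph_dist_def by blast
qed

lemma graph_dist_nonneg: "x \<in> pts \<Longrightarrow> y \<in> pts \<Longrightarrow> 0 \<le> gdist x y"
  using graph_dist_less_path[of x y 0] by (meson not_le path_length_nonneg)

lemma graph_dist_triangle:
  assumes "x \<in> pts" "y \<in> pts" "z \<in> pts"
  shows "gdist x z \<le> gdist x y + gdist y z"
proof (rule field_le_epsilon)
  fix e :: real
  assume "0 < e"
  then have "gdist x y < gdist x y + e/2" "gdist y z < gdist y z + e/2" by auto
  then obtain l l' where "path_length E x y l" "l < gdist x y + e/2"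
    "path_length E y z l'" "l' < gdist y z + e/2"
    using graph_dist_less_path assms by meson
  then show "gdist x z \<le> gdist x y + gdist y z + e"
    using graph_dist_le path_length_trans by fastforce
qed

lemma dist_adjacent: "{u, v} \<in> E \<Longrightarrow> gdist (vertex_point u) (vertex_point v) \<le> 1"
  using graph_dist_le[OF path_length_relpow[of u v 1]] by simp

text \<open>A path can be straightened: either it stays in one edge, or it runs through a walk of
  vertices that starts and ends in the supports of its end points.\<close>

lemma path_length_cases:
  assumes "path_length E x y l" "x \<in> pts"
  shows "(\<exists>a b s t. {a, b} \<in> E \<and> 0 \<le> s \<and> s \<le> 1 \<and> 0 \<le> t \<and> t \<le> 1 \<and>
            x = edge_point a b s \<and> y = edge_point a b t \<and> \<bar>s - t\<bar> \<le> l) \<or>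
         (\<exists>u v n. 0 < x u \<and> 0 < y v \<and> (u, v) \<in> adj E ^^ n \<and>
            (1 - x u) + real n + (1 - y v) \<le> l)"
    (is "?edge y l \<or> ?walk y l")
  using assms(1)
proof (induction)
  case refl
  show ?case using assms(2)
  proof (cases rule: pts_cases)
    case (vertex u)
    then have "0 < x u \<and> 0 < x u \<and> (u, u) \<in> adj E ^^ 0 \<and> (1 - x u) + real 0 + (1 - x u) \<le> 0"
      by simp
    then have "?walk x 0" by blast
    then show ?thesis by simp
  next
    case (edge u v t)
    then have "?edge x 0" by (intro exI[of _ u] exI[of _ v] exI[of _ t]) auto
    then show ?thesis by simp
  qed
next
  case (step u v s l t)
  \<comment> \<open>One more segment on an edge entered at \<open>u\<close>. Unless the segment ends
    at \<open>v\<close>, the walk may stop at \<open>u\<close> as before; if it does end there, the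
    coordinate at \<open>u\<close> has dropped to 0 and the walk is prolonged to
    \<open>v\<close>.\<close>
  have ends: "?walk (edge_point u v t) (l + \<bar>s - t\<bar>)"
    if e: "{u, v} \<in> E" "0 \<le> s" "s \<le> 1" "0 \<le> t" "t \<le> 1" and
      w: "0 < x a" "0 < edge_point u v s u" "(a, u) \<in> adj E ^^ n"
      "(1 - x a) + real n + (1 - edge_point u v s u) \<le> l" for u v s t a n
  proof (cases "t = 1")
    case True
    have "(a, v) \<in> adj E ^^ Suc n" using w e by auto
    moreover have "0 < edge_point u v t v" "1 - edge_point u v t v = 0"
      using True edge_neq[OF e(1)] edge_point_second[of u v t] by auto
    moreover have "(1 - x a) + real (Suc n) + (1 - edge_point u v t v) \<le> l + \<bar>s - t\<bar>"
      using calculation w e True by simp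
    ultimately show ?thesis using w(1) by blast
  next
    case False
    then have "0 < edge_point u v t u" using e by simp
    moreover have "(1 - x a) + real n + (1 - edge_point u v t u) \<le> l + \<bar>s - t\<bar>"
      using w e by simp
    ultimately show ?thesis using w by blast
  qed
  have walk: "?walk (edge_point u v t) (l + \<bar>s - t\<bar>)" if w: "?walk (edge_point u v s) l"
  proof -
    from w obtain a b n where ab: "0 < x a" "0 < edge_point u v s b" "(a, b) \<in> adj E ^^ n"
      "(1 - x a) + real n + (1 - edge_point u v s b) \<le> l" by blast
    have "b = u \<or> b = v" using ab(2) by (rule edge_point_pos_iff)
    then show ?thesis
    proof
      assume "b = u"
      then show ?thesis using ends[of u v s t a n] ab step by blast
    next
      assume bv: "b = v"
      have sw: "edge_point u v r = edge_point v u (1 - r)" for r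
        by (rule edge_point_swap[OF edge_neq[OF step.hyps(2)]])
      have "?walk (edge_point v u (1 - t)) (l + \<bar>(1 - s) - (1 - t)\<bar>)"
        using ends[of v u "1 - s" "1 - t" a n] ab step bv unfolding sw
        by (simp add: insert_commute)
      then show ?thesis unfolding sw by (simp add: abs_minus_commute)
    qed
  qed
  show ?case
    using step.IH
  proof
    assume "?walk (edge_point u v s) l"
    then show ?thesis using walk by blast
  next
    assume "?edge (edge_point u v s) l"
    then obtain a b s0 t0 where ab: "{a, b} \<in> E" "0 \<le> s0" "s0 \<le> 1" "0 \<le> t0" "t0 \<le> 1"
      "x = edge_point a b s0" "edge_point u v s = edge_point a b t0" "\<bar>s0 - t0\<bar> \<le> l" by blast
    have swap: "edge_point u v r = edge_point v u (1 - r)"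
      "edge_point a b r = edge_point b a (1 - r)" for r
      by (rule edge_point_swap[OF edge_neq[OF step.hyps(2)]],
          rule edge_point_swap[OF edge_neq[OF ab(1)]])
    \<comment> \<open>The path has stayed in its first edge and now stands at the vertex
      \<open>a\<close>, from where it may enter another edge. This is a walk of length 0 at
      \<open>a\<close>, or of length 1 from \<open>b\<close> if \<open>s0 = 1\<close>, when
      \<open>x\<close> is the vertex \<open>b\<close> itself.\<close>
    have at_start: "?walk (edge_point u v s) l"
      if q: "edge_point u v s = vertex_point a" and
         ab: "{a, b} \<in> E" "0 \<le> s0" "s0 \<le> 1" "x = edge_point a b s0" "s0 \<le> l" for a b s0
    proof (cases "s0 = 1")
      case True
      have "(b, a) \<in> adj E ^^ 1" using ab by (simp add: insert_commute)
      moreover have "x b = 1" using True ab edge_neq[of a b] edge_point_second[of a b 1] by simp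
      ultimately show ?thesis using ab True q
        by (intro exI[of _ b] exI[of _ a] exI[of _ "1::nat"]) auto
    next
      case False
      then show ?thesis using ab q
        by (intro exI[of _ a] exI[of _ a] exI[of _ "0::nat"]) auto
    qed
    consider "t0 = 0" | "t0 = 1" | "0 < t0" "t0 < 1" using ab by linarith
    then show ?thesis
    proof cases
      case 1
      then have "?walk (edge_point u v s) l" using at_start[of a b s0] ab by simp
      then show ?thesis using walk by blast
    next
      case 2
      then have "?walk (edge_point u v s) l" using at_start[of b a "1 - s0"] ab swap(2)
        by (simp add: insert_commute)
      then show ?thesis using walk by blast
    next
      case 3
      have "0 < edge_point u v s a" "0 < edge_point u v s b"
        using 3 ab edge_neq[of a b] edge_point_second[of a b t0] by auto
      then have "a = u \<and> b = v \<or> a = v \<and> b = u"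
        using edge_point_pos_iff[of u v s] edge_neq[OF ab(1)] by blast
      then show ?thesis
      proof
        assume *: "a = u \<and> b = v"
        moreover have "s = t0" using * arg_cong[OF ab(7), of "\<lambda>f. f u"] by simp
        ultimately have "?edge (edge_point u v t) (l + \<bar>s - t\<bar>)"
          using ab step by (intro exI[of _ u] exI[of _ v] exI[of _ s0] exI[of _ t]) auto
        then show ?thesis by blast
      next
        assume *: "a = v \<and> b = u"
        have "s = 1 - t0"
          using * arg_cong[OF ab(7), of "\<lambda>f. f u"] edge_point_second[OF edge_neq[OF ab(1)], of t0]
          by simp
        then have "?edge (edge_point u v t) (l + \<bar>s - t\<bar>)"
          using ab step * swap(1)[of t] by (intro exI[of _ v] exI[of _ u] exI[of _ s0] exI[of _ "1 - t"]) auto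
        then show ?thesis by blast
      qed
    qed
  qed
qed

end

section \<open>Vertex sequences indexed by integers and parametrised by arc length\<close>

definition walk_point :: "(int \<Rightarrow> 'a) \<Rightarrow> real \<Rightarrow> ('a \<Rightarrow> real)" where
  "walk_point w s = edge_point (w \<lfloor>s\<rfloor>) (w (\<lfloor>s\<rfloor> + 1)) (s - of_int \<lfloor>s\<rfloor>)"

lemma walk_point_int [simp]: "walk_point w (of_int i) = vertex_point (w i)"
  by (simp add: walk_point_def)

lemma walk_point_edge:
  assumes "of_int i \<le> s" "s \<le> of_int i + 1" "w i \<noteq> w (i + 1)"
  shows "walk_point w s = edge_point (w i) (w (i + 1)) (s - of_int i)"
proof (cases "s = of_int i + 1")
  case True
  then have "s = of_int (i + 1)" by simp
  then show ?thesis using walk_point_int[of w "i + 1"] edge_point_1[OF assms(3)] True by simp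
next
  case False
  then have "\<lfloor>s\<rfloor> = i" using assms by (intro floor_unique) auto
  then show ?thesis by (simp add: walk_point_def)
qed

lemma walk_point_shift: "walk_point (\<lambda>i. w (i + k)) s = walk_point w (s + of_int k)"
  by (simp add: walk_point_def add.assoc add.commute add.left_commute)

context metric_graph
begin

text \<open>Straightened paths of length at most \<open>d + 1\<close> have finitely many lengths, so
  the infimum is attained. Positions at the end of an edge are moved to the walk case, which leaves
  both points strictly inside the edge in the other one.\<close>

lemma graph_dist_cases:
  assumes x: "x \<in> pts" and y: "y \<in> pts"
  obtains (edge) a b s t where "{a, b} \<in> E" "0 < s" "s < 1" "0 < t" "t < 1"
      "x = edge_point a b s" "y = edge_point a b t" "gdist x y = \<bar>s - t\<bar>"
  | (walk) u v n where "0 < x u" "0 < y v" "(u, v) \<in> adj E ^^ n"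
      "gdist x y = (1 - x u) + real n + (1 - y v)"
proof -
  define C1 where "C1 = {c. \<exists>a b s t. {a, b} \<in> E \<and> 0 \<le> s \<and> s \<le> 1 \<and> 0 \<le> t \<and> t \<le> 1 \<and>
      x = edge_point a b s \<and> y = edge_point a b t \<and> c = \<bar>s - t\<bar>}"
  define C2 where "C2 = {c. \<exists>u v n. 0 < x u \<and> 0 < y v \<and> (u, v) \<in> adj E ^^ n \<and>
      c = (1 - x u) + real n + (1 - y v)}"
  define d where "d = gdist x y"
  define C where "C = (C1 \<union> C2) \<inter> {..d + 1}"
  have cand: "\<exists>c\<in>C1 \<union> C2. c \<le> l" if "path_length E x y l" for l
    using path_length_cases[OF that x] unfolding C1_def C2_def by blast
  have "path_length E x y c" if "c \<in> C1" for c
    using that unfolding C1_def by (auto intro: path_length_edge)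
  moreover have "path_length E x y c" if "c \<in> C2" for c
    using that path_length_walk[OF x y] unfolding C2_def by blast
  ultimately have path: "d \<le> c" if "c \<in> C1 \<union> C2" for c
    using that graph_dist_le unfolding d_def by (metis Un_iff)
  have "C1 \<subseteq> (\<lambda>a. \<bar>x a - y a\<bar>) ` V"
  proof
    fix c assume "c \<in> C1"
    then obtain a b s t where *: "{a, b} \<in> E" "x = edge_point a b s" "y = edge_point a b t" "c = \<bar>s - t\<bar>"
      unfolding C1_def by blast
    then have "c = \<bar>x a - y a\<bar>" by simp
    then show "c \<in> (\<lambda>a. \<bar>x a - y a\<bar>) ` V" using edge_in_V[OF *(1)] by blast
  qed
  moreover have "C2 \<inter> {..d + 1} \<subseteq>
      (\<lambda>(u, v, n). (1 - x u) + real n + (1 - y v)) ` (V \<times> V \<times> {..nat \<lceil>d + 1\<rceil>})"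
  proof
    fix c assume "c \<in> C2 \<inter> {..d + 1}"
    then obtain u v n where *: "0 < x u" "0 < y v" "c = (1 - x u) + real n + (1 - y v)" "c \<le> d + 1"
      unfolding C2_def by blast
    moreover have "x u \<le> 1" "y v \<le> 1" using pts_le_1 x y by auto
    ultimately have "real n \<le> d + 1" by linarith
    then have "n \<le> nat \<lceil>d + 1\<rceil>" by linarith
    moreover have "u \<in> V" "v \<in> V" using pts_pos_in_V x y * by auto
    ultimately show "c \<in> (\<lambda>(u, v, n). (1 - x u) + real n + (1 - y v)) ` (V \<times> V \<times> {..nat \<lceil>d + 1\<rceil>})"
      using * by (intro image_eqI[of _ _ "(u, v, n)"]) auto
  qed
  ultimately have fin: "finite C"
    using finite_V finite_subset[of C1 "(\<lambda>a. \<bar>x a - y a\<bar>) ` V"]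
      finite_subset[of "C2 \<inter> {..d + 1}"] unfolding C_def Int_Un_distrib2 by blast
  have ne: "C \<noteq> {}"
  proof -
    obtain l where "path_length E x y l" "l < d + 1"
      using graph_dist_less_path[OF x y, of "d + 1"] by (auto simp: d_def)
    then show ?thesis using cand[of l] unfolding C_def by force
  qed
  have "Min C \<le> d"
  proof (rule ccontr)
    assume "\<not> Min C \<le> d"
    then have "d < Min C" by simp
    then obtain l where l: "path_length E x y l" "l < Min C"
      using graph_dist_less_path[OF x y, of "Min C"] unfolding d_def by blast
    then obtain c where c: "c \<in> C1 \<union> C2" "c \<le> l" using cand by blast
    moreover have "Min C \<le> d + 1" using Min_in[OF fin ne] unfolding C_def by simp
    ultimately have "c \<in> C" using l unfolding C_def by auto
    then show False using Min_le[OF fin] c l by fastforce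
  qed
  moreover have "Min C \<in> C1 \<union> C2" using Min_in[OF fin ne] unfolding C_def by blast
  ultimately have "d \<in> C1 \<union> C2" using path[of "Min C"] by (simp add: order_antisym)
  then show thesis
  proof
    assume "d \<in> C2"
    then show thesis using walk unfolding C2_def d_def by blast
  next
    assume "d \<in> C1"
    then obtain a b s t where *: "{a, b} \<in> E" "0 \<le> s" "s \<le> 1" "0 \<le> t" "t \<le> 1"
      "x = edge_point a b s" "y = edge_point a b t" "d = \<bar>s - t\<bar>"
      unfolding C1_def by blast
    have ba: "edge_point a b r = edge_point b a (1 - r)" for r
      by (rule edge_point_swap[OF edge_neq[OF *(1)]])
    have from_vertex: "\<exists>u v n. 0 < x' u \<and> 0 < y' v \<and> (u, v) \<in> adj E ^^ n \<and> r = (1 - x' u) + real n + (1 - y' v)"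
      if "{a, b} \<in> E" "x' = vertex_point a" "y' = edge_point a b r" "0 \<le> r" "r \<le> 1" for x' y' a b r
    proof (cases "r = 1")
      case True
      then have "y' = vertex_point b" using that edge_point_1 edge_neq by metis
      then show ?thesis using that True
        by (intro exI[of _ a] exI[of _ b] exI[of _ "1::nat"]) (auto simp del: One_nat_def)
    next
      case False
      then show ?thesis using that by (intro exI[of _ a] exI[of _ a] exI[of _ "0::nat"]) auto
    qed
    have adj_sym: "(v, u) \<in> adj E ^^ n" if "(u, v) \<in> adj E ^^ n" for u v n
      using that
    proof (induction n arbitrary: v)
      case (Suc n)
      then obtain z where "(u, z) \<in> adj E ^^ n" "{v, z} \<in> E" by (auto simp: insert_commute)
      then show ?case using Suc.IH by (intro relpow_Suc_I2[of v z]) auto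
    qed simp
    have walk': thesis if "\<exists>u v n. 0 < y u \<and> 0 < x v \<and> (u, v) \<in> adj E ^^ n \<and> d = (1 - y u) + real n + (1 - x v)"
    proof -
      from that obtain u v n where "0 < y u" "0 < x v" "(u, v) \<in> adj E ^^ n"
        "d = (1 - y u) + real n + (1 - x v)" by blast
      then show thesis using adj_sym by (intro walk[of v u n]) (auto simp: d_def)
    qed
    consider "s = 0" | "s = 1" | "t = 0" | "t = 1" | "0 < s" "s < 1" "0 < t" "t < 1" using * by linarith
    then show thesis
    proof cases
      case 1
      then show thesis using from_vertex[of a b x y t] * walk unfolding d_def by auto
    next
      case 2
      then show thesis using from_vertex[of b a x y "1 - t"] * ba walk
        unfolding d_def by (auto simp: insert_commute)
    next
      case 3
      then show thesis using from_vertex[of a b y x s] * walk' by auto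
    next
      case 4
      then show thesis using from_vertex[of b a y x "1 - s"] * ba walk' by (auto simp: insert_commute)
    next
      case 5
      then show thesis using * edge unfolding d_def by blast
    qed
  qed
qed

lemma walk_point_in_pts:
  assumes "\<And>i. lo \<le> i \<Longrightarrow> i < hi \<Longrightarrow> {w i, w (i + 1)} \<in> E" "lo < hi"
    "of_int lo \<le> s" "s \<le> of_int hi"
  shows "walk_point w s \<in> pts"
proof (cases "s = of_int hi")
  case True
  then show ?thesis using assms(1)[of "hi - 1"] assms(2) edge_in_V vertex_in_pts by force
next
  case False
  then have "\<lfloor>s\<rfloor> < hi" "lo \<le> \<lfloor>s\<rfloor>" using assms by (auto simp: floor_less_iff le_floor_iff)
  then show ?thesis unfolding walk_point_def using assms(1)
    by (intro edge_point_in_pts) (auto, linarith+)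
qed

lemma walk_point_dist_le:
  assumes walk: "\<And>i. lo \<le> i \<Longrightarrow> i < hi \<Longrightarrow> {w i, w (i + 1)} \<in> E"
    and s: "of_int lo \<le> s" "s \<le> s'" "s' \<le> of_int hi"
  shows "gdist (walk_point w s) (walk_point w s') \<le> s' - s"
proof (cases "lo < hi")
  case False
  then have "s = s'" using s by linarith
  then show ?thesis by simp
next
  case True
  note in_pts = walk_point_in_pts[of lo hi w, OF walk True]
  have edge: "gdist (walk_point w s) (walk_point w s') \<le> s' - s"
    if "of_int i \<le> s" "s \<le> s'" "s' \<le> of_int i + 1" "lo \<le> i" "i < hi" for i s s'
  proof -
    have e: "{w i, w (i + 1)} \<in> E" using walk that by simp
    have "gdist (edge_point (w i) (w (i + 1)) (s - of_int i)) (edge_point (w i) (w (i + 1)) (s' - of_int i))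
        \<le> \<bar>(s - of_int i) - (s' - of_int i)\<bar>"
      using e that by (intro graph_dist_le path_length_edge) auto
    then show ?thesis using walk_point_edge[of i s w] walk_point_edge[of i s' w] that edge_neq[OF e] by simp
  qed
  have "gdist (walk_point w s) (walk_point w s') \<le> s' - s"
    if "s \<le> s'" "s' \<le> of_int hi" "s' \<le> of_int \<lfloor>s\<rfloor> + 1 + real n" for n s'
    using that
  proof (induction n arbitrary: s')
    case 0
    have "lo \<le> \<lfloor>s\<rfloor>" using s by (simp add: le_floor_iff)
    show ?case
    proof (cases "\<lfloor>s\<rfloor> < hi")
      case True
      then show ?thesis using 0 s \<open>lo \<le> \<lfloor>s\<rfloor>\<close> by (intro edge[of "\<lfloor>s\<rfloor>"]) auto
    next
      case False
      then have "s = s'" using 0 by linarith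
      then show ?thesis by simp
    qed
  next
    case (Suc n)
    define m where "m = \<lfloor>s\<rfloor> + 1 + int n"
    show ?case
    proof (cases "s' \<le> of_int m")
      case True
      then show ?thesis using Suc unfolding m_def by simp
    next
      case False
      have sm: "s \<le> of_int m" unfolding m_def by simp linarith
      then have "gdist (walk_point w s) (walk_point w (of_int m)) \<le> of_int m - s"
        using False Suc by (intro Suc.IH) (auto simp: m_def)
      moreover have "gdist (walk_point w (of_int m)) (walk_point w s') \<le> s' - of_int m"
      proof (rule edge)
        show "s' \<le> of_int m + 1" using Suc.prems by (simp add: m_def)
        have "of_int lo \<le> (of_int m :: real)" using sm s by linarith
        then show "lo \<le> m" by simp
        have "of_int m < (of_int hi :: real)" using False Suc.prems by linarith
        then show "m < hi" by simp
      qed (use False in auto)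
      moreover have "gdist (walk_point w s) (walk_point w s') \<le>
          gdist (walk_point w s) (walk_point w (of_int m)) + gdist (walk_point w (of_int m)) (walk_point w s')"
        using s sm False Suc.prems by (intro graph_dist_triangle in_pts) auto
      ultimately show ?thesis by linarith
    qed
  qed
  from this[of s' "nat (\<lceil>s'\<rceil> - \<lfloor>s\<rfloor>)"] show ?thesis using s by linarith
qed

text \<open>A curve of speed at most 1 whose end points are as far apart as its length allows cannot
  lose distance on any part.\<close>

lemma walk_point_isometric:
  assumes walk: "\<And>i. lo \<le> i \<Longrightarrow> i < hi \<Longrightarrow> {w i, w (i + 1)} \<in> E" and "lo < hi"
    and "of_int lo \<le> a" "b \<le> of_int hi" "gdist (walk_point w a) (walk_point w b) = b - a"
    and s: "a \<le> s" "s \<le> s'" "s' \<le> b"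
  shows "gdist (walk_point w s) (walk_point w s') = s' - s"
proof (rule antisym)
  note in_pts = walk_point_in_pts[of lo hi w, OF walk \<open>lo < hi\<close>]
  note le = walk_point_dist_le[of lo hi w, OF walk]
  show "gdist (walk_point w s) (walk_point w s') \<le> s' - s" using assms by (intro le) auto
  have "gdist (walk_point w a) (walk_point w b) \<le>
      gdist (walk_point w a) (walk_point w s) + gdist (walk_point w s) (walk_point w b)"
    using assms by (intro graph_dist_triangle in_pts) auto
  moreover have "gdist (walk_point w s) (walk_point w b) \<le>
      gdist (walk_point w s) (walk_point w s') + gdist (walk_point w s') (walk_point w b)"
    using assms by (intro graph_dist_triangle in_pts) auto
  moreover have "gdist (walk_point w a) (walk_point w s) \<le> s - a" using assms by (intro le) auto
  moreover have "gdist (walk_point w s') (walk_point w b) \<le> b - s'" using assms by (intro le) auto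
  ultimately show "s' - s \<le> gdist (walk_point w s) (walk_point w s')" using assms(5) by linarith
qed

text \<open>\<open>1 < D\<close> prevents \<open>p\<close> and \<open>x\<close> from lying inside a
  common edge. The walk is prolonged past \<open>x\<close> to the far end of the edge of
  \<open>x\<close>, with overshoot \<open>\<beta>\<close>, so that \<open>x\<close> always sits on
  the last edge. The final conclusion records that reaching \<open>v\<close> first costs
  nothing.\<close>

lemma half_geodesic_walk:
  assumes p: "p \<in> pts" and x: "x \<in> pts" and D: "gdist p x = D" "1 < D"
  obtains v f M \<beta> where "0 < p v" "f 0 = v" "1 \<le> M" "\<And>i. i < M \<Longrightarrow> {f i, f (Suc i)} \<in> E"
    "0 \<le> \<beta>" "\<beta> < 1" "x = edge_point (f M) (f (M - 1)) \<beta>" "D = (1 - p v) + real M - \<beta>"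
    "gdist (vertex_point v) x \<le> D - (1 - p v)"
  using p x
proof (cases rule: graph_dist_cases)
  case (edge a b s t)
  then show ?thesis using D by linarith
next
  case (walk v e n)
  obtain f where f: "f 0 = v" "f n = e" "\<forall>i<n. {f i, f (Suc i)} \<in> E"
    using walk(3) unfolding relpow_fun_conv by auto
  have "gdist (vertex_point v) x \<le> real n + (1 - x e)"
    using graph_dist_le[OF path_length_trans[OF path_length_sym[OF path_length_to_vertex[OF x walk(2)]]
          path_length_relpow[OF walk(3)]]] .
  then have v: "gdist (vertex_point v) x \<le> D - (1 - p v)" using walk D by linarith
  from x show ?thesis
  proof (cases rule: pts_cases)
    case (vertex u)
    then have u: "e = u" "x e = 1" using walk by auto
    then have "1 \<le> n" using walk D by (cases n) auto
    then show ?thesis using that[of v f n 0] walk f vertex u D v by auto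
  next
    case (edge a b t)
    have ab: "a \<noteq> b" using edge edge_neq by blast
    have "e = a \<or> e = b" using walk edge edge_point_pos_iff by force
    then obtain e' where e': "{e', e} \<in> E" "x = edge_point e' e (x e)" "x e < 1"
    proof
      assume "e = a"
      then show thesis using that[of b] edge edge_point_swap[OF ab, of t]
          edge_point_second[OF ab[symmetric], of "1 - t"] by (simp add: insert_commute)
    next
      assume "e = b"
      then show thesis using that[of a] edge edge_point_second[OF ab] by simp
    qed
    show ?thesis
    proof (rule that[of v "f(Suc n := e')" "Suc n" "x e"])
      show "{(f(Suc n := e')) i, (f(Suc n := e')) (Suc i)} \<in> E" if "i < Suc n" for i
        using that f e' by (cases "i = n") (auto simp: insert_commute)
    qed (use walk f e' D v in auto)
  qed
qed

text \<open>The two half walks are glued at \<open>p\<close>. If \<open>p\<close> is inside an edge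
  they leave it by different ends: a common first vertex would let \<open>x\<close> and
  \<open>y\<close> be joined without the segment to \<open>p\<close>, hence by less than
  \<open>2 * D\<close>.\<close>

lemma geodesic_walk_through:
  assumes p: "p \<in> pts" and x: "x \<in> pts" and y: "y \<in> pts" and D: "1 < D"
    "gdist p x = D" "gdist p y = D" "gdist x y = 2 * D"
  obtains w lo hi t where "\<And>i. lo \<le> i \<Longrightarrow> i < hi \<Longrightarrow> {w i, w (i + 1)} \<in> E"
    "of_int lo \<le> t - D" "t - D < of_int lo + 1" "of_int hi - 1 < t + D" "t + D \<le> of_int hi"
    "p = walk_point w t" "x = walk_point w (t - D)" "y = walk_point w (t + D)"
proof -
  obtain v f M \<beta> where f: "0 < p v" "f 0 = v" "1 \<le> M" "\<And>i. i < M \<Longrightarrow> {f i, f (Suc i)} \<in> E"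
    "0 \<le> \<beta>" "\<beta> < 1" "x = edge_point (f M) (f (M - 1)) \<beta>" "D = (1 - p v) + real M - \<beta>"
    "gdist (vertex_point v) x \<le> D - (1 - p v)"
    by (rule half_geodesic_walk[OF p x D(2,1)]) blast
  obtain v' f' M' \<beta>' where f': "0 < p v'" "f' 0 = v'" "1 \<le> M'" "\<And>i. i < M' \<Longrightarrow> {f' i, f' (Suc i)} \<in> E"
    "0 \<le> \<beta>'" "\<beta>' < 1" "y = edge_point (f' M') (f' (M' - 1)) \<beta>'" "D = (1 - p v') + real M' - \<beta>'"
    "gdist (vertex_point v') y \<le> D - (1 - p v')"
    by (rule half_geodesic_walk[OF p y D(3,1)]) blast
  \<comment> \<open>\<open>k\<close> counts the edges between the first vertices of the two halves:
    0 if \<open>p\<close> is a vertex, 1 if \<open>p\<close> lies inside the edge from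
    \<open>v\<close> to \<open>v'\<close>.\<close>
  have "\<exists>k. k = (0::int) \<and> v = v' \<and> p = vertex_point v \<and> p v = 1 \<or>
      k = 1 \<and> {v, v'} \<in> E \<and> p = edge_point v v' (1 - p v) \<and> p v + p v' = 1 \<and> p v < 1"
    using p
  proof (cases rule: pts_cases)
    case (vertex u)
    then have "v = u" "v' = u" using f f' by auto
    then show ?thesis using vertex by auto
  next
    case (edge a b t)
    have ab: "a \<noteq> b" using edge edge_neq by blast
    have vs: "v = a \<or> v = b" "v' = a \<or> v' = b" using f f' edge edge_point_pos_iff by force+
    have "v \<noteq> v'"
    proof
      assume v: "v = v'"
      have "v \<in> V" using vs edge edge_in_V by auto
      then have "gdist x y \<le> gdist x (vertex_point v) + gdist (vertex_point v) y"
        by (intro graph_dist_triangle x y vertex_in_pts)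
      then have "2 * D \<le> 2 * D - 2 * (1 - p v)"
        using f f' v D graph_dist_sym[of E x] by simp
      moreover have "p v < 1" using vs edge edge_point_second[OF ab, of t] by auto
      ultimately show False by simp
    qed
    then have "v = a \<and> v' = b \<or> v = b \<and> v' = a" using vs by auto
    then show ?thesis
    proof
      assume "v = a \<and> v' = b"
      then show ?thesis using edge edge_point_second[OF ab] by auto
    next
      assume "v = b \<and> v' = a"
      then show ?thesis using edge edge_point_second[OF ab] edge_point_swap[OF ab, of t]
          edge_point_second[OF ab[symmetric]] by (auto simp: insert_commute)
    qed
  qed
  then obtain k where k: "k = (0::int) \<and> v = v' \<and> p = vertex_point v \<and> p v = 1 \<or>
      k = 1 \<and> {v, v'} \<in> E \<and> p = edge_point v v' (1 - p v) \<and> p v + p v' = 1 \<and> p v < 1" by blast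
  \<comment> \<open>The first half is run backwards on the indices up to 0, the second forwards from
    \<open>k\<close>; since \<open>w 0 = v\<close>, the point \<open>p\<close> sits at parameter
    \<open>1 - p v\<close>.\<close>
  define w where "w i = (if i \<le> 0 then f (nat (- i)) else f' (nat (i - k)))" for i
  define t where "t = 1 - p v"
  have w_left: "w (- int i) = f i" for i by (simp add: w_def)
  have w_right: "w (k + int i) = f' i" for i
    using k f(2) f'(2) by (cases i) (auto simp: w_def nat_add_distrib)
  have walk: "{w i, w (i + 1)} \<in> E" if "- int M \<le> i" "i < k + int M'" for i
  proof -
    consider "i < 0" | "i = 0" "k = 1" | "k \<le> i" using k by fastforce
    then show ?thesis
    proof cases
      case 1
      then obtain j where "i = - int (Suc j)" by (metis negD)
      then show ?thesis using w_left[of "Suc j"] w_left[of j] f(4)[of j] that by (auto simp: insert_commute)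
    next
      case 2
      then show ?thesis using k w_left[of 0] w_right[of 0] f f' by auto
    next
      case 3
      then obtain j where "i = k + int j" using zle_iff_zadd by blast
      then show ?thesis using w_right[of j] w_right[of "Suc j"] f'(4)[of j] that by (auto simp: add.assoc add.commute add.left_commute)
    qed
  qed
  have t: "of_int k = (1 - p v) + (1 - p v')" "0 \<le> t" "t < 1" using k f(1) unfolding t_def by auto
  have x_eq: "x = walk_point w (t - D)"
  proof -
    have e: "{w (- int M), w (- int M + 1)} \<in> E" using walk f(3) k by force
    have "w (- int M + 1) = f (M - 1)" using w_left[of "M - 1"] f(3) by (simp add: of_nat_diff)
    then have "x = edge_point (w (- int M)) (w (- int M + 1)) \<beta>" using f w_left by simp
    moreover have r: "t - D - of_int (- int M) = \<beta>" using f(8) by (simp add: t_def)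
    moreover have "walk_point w (t - D) = edge_point (w (- int M)) (w (- int M + 1)) (t - D - of_int (- int M))"
      by (rule walk_point_edge) (use r f edge_neq[OF e] in auto)
    ultimately show ?thesis by metis
  qed
  have y_eq: "y = walk_point w (t + D)"
  proof -
    define h where "h = k + int (M' - 1)"
    have h: "h + 1 = k + int M'" using f' by (simp add: h_def)
    have e: "{w h, w (h + 1)} \<in> E" using walk[of h] f'(3) k h by force
    have "y = edge_point (w (h + 1)) (w h) \<beta>'" unfolding h using f'(7) w_right by (simp add: h_def)
    then have "y = edge_point (w h) (w (h + 1)) (1 - \<beta>')"
      using edge_point_swap[of "w (h + 1)" "w h"] edge_neq[OF e] by auto
    moreover have r: "t + D - of_int h = 1 - \<beta>'"
      using arg_cong[OF h, of real_of_int] t f'(8) by (simp add: t_def)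
    moreover have "walk_point w (t + D) = edge_point (w h) (w (h + 1)) (t + D - of_int h)"
      by (rule walk_point_edge) (use r f' edge_neq[OF e] in auto)
    ultimately show ?thesis by metis
  qed
  have p_eq: "p = walk_point w t"
    using k
  proof
    assume "k = 0 \<and> v = v' \<and> p = vertex_point v \<and> p v = 1"
    then show ?thesis using walk_point_int[of w 0] w_left[of 0] f by (simp add: t_def)
  next
    assume *: "k = 1 \<and> {v, v'} \<in> E \<and> p = edge_point v v' (1 - p v) \<and> p v + p v' = 1 \<and> p v < 1"
    then have "w 0 = v" "w 1 = v'" using w_left[of 0] w_right[of 0] f f' by auto
    then show ?thesis using walk_point_edge[of 0 t w] t * edge_neq by (simp add: t_def)
  qed
  show thesis
  proof (rule that[of "- int M" "k + int M'" w t])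
    show "of_int (- int M) \<le> t - D" "t - D < of_int (- int M) + 1" using f by (auto simp: t_def)
    show "of_int (k + int M') - 1 < t + D" "t + D \<le> of_int (k + int M')"
      using f' t(1) by (auto simp: t_def)
  qed (use walk x_eq y_eq p_eq in auto)
qed

end

lemma walk_point_cong:
  assumes "\<And>i. lo \<le> i \<Longrightarrow> i \<le> hi \<Longrightarrow> w i = w' i" "of_int lo \<le> s" "s \<le> of_int hi"
  shows "walk_point w s = walk_point w' s"
proof (cases "s = of_int hi")
  case True
  moreover have "lo \<le> hi" using assms(2,3) by linarith
  ultimately show ?thesis using assms(1) by simp
next
  case False
  then have "\<lfloor>s\<rfloor> < hi" "lo \<le> \<lfloor>s\<rfloor>" using assms by (auto simp: floor_less_iff le_floor_iff)
  then show ?thesis using assms(1)[of "\<lfloor>s\<rfloor>"] assms(1)[of "\<lfloor>s\<rfloor> + 1"] by (simp add: walk_point_def)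
qed

section \<open>Cycles as periodic walks\<close>

text \<open>A cycle unrolled over the integers: rotation and reversal become substitutions for the
  index, and an arc across the starting vertex needs no case distinction.\<close>

definition cyclic_walk :: "'a set set \<Rightarrow> nat \<Rightarrow> (int \<Rightarrow> 'a) \<Rightarrow> bool" where
  "cyclic_walk E L w \<longleftrightarrow> 3 \<le> L \<and> inj_on w {0..<int L} \<and>
     (\<forall>i. w (i + int L) = w i) \<and> (\<forall>i. {w i, w (i + 1)} \<in> E)"

lemma cyclic_walkD:
  assumes "cyclic_walk E L w"
  shows "3 \<le> L" "inj_on w {0..<int L}" "w (i + int L) = w i" "{w i, w (i + 1)} \<in> E"
  using assms by (auto simp: cyclic_walk_def)

lemma cyclic_walk_add_mult:
  assumes "cyclic_walk E L w"
  shows "w (i + k * int L) = w i"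
proof -
  have nat: "w (j + int n * int L) = w j" for j n
  proof (induction n)
    case (Suc n)
    then show ?case using cyclic_walkD(3)[OF assms, of "j + int n * int L"] by (simp add: algebra_simps)
  qed simp
  show ?thesis
  proof (cases "0 \<le> k")
    case True
    then show ?thesis using nat[of i "nat k"] by simp
  next
    case False
    then show ?thesis using nat[of "i + k * int L" "nat (- k)"] by (simp add: algebra_simps)
  qed
qed

lemma cyclic_walk_mod: "cyclic_walk E L w \<Longrightarrow> w (i mod int L) = w i"
  using cyclic_walk_add_mult[of E L w "i mod int L" "i div int L"] by simp

lemma cyclic_walk_eq_iff:
  assumes "cyclic_walk E L w"
  shows "w i = w j \<longleftrightarrow> i mod int L = j mod int L"
proof
  assume "w i = w j"
  then have "w (i mod int L) = w (j mod int L)" using cyclic_walk_mod[OF assms] by simp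
  moreover have "i mod int L \<in> {0..<int L}" "j mod int L \<in> {0..<int L}"
    using cyclic_walkD(1)[OF assms] by auto
  ultimately show "i mod int L = j mod int L" using cyclic_walkD(2)[OF assms] by (simp add: inj_on_def)
next
  assume "i mod int L = j mod int L"
  then show "w i = w j" using cyclic_walk_mod[OF assms] by metis
qed

lemma cyclic_walk_shift:
  assumes "cyclic_walk E L w"
  shows "cyclic_walk E L (\<lambda>i. w (i + k))"
  unfolding cyclic_walk_def
proof (intro conjI allI)
  show "inj_on (\<lambda>i. w (i + k)) {0..<int L}"
  proof (rule inj_onI)
    fix i j assume ij: "i \<in> {0..<int L}" "j \<in> {0..<int L}" "w (i + k) = w (j + k)"
    then have "(i + k) mod int L = (j + k) mod int L" using cyclic_walk_eq_iff[OF assms] by simp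
    then have "i mod int L = j mod int L" by (simp add: mod_eq_dvd_iff)
    then show "i = j" using ij by simp
  qed
  show "w (i + int L + k) = w (i + k)" for i
    using cyclic_walkD(3)[OF assms, of "i + k"] by (simp add: algebra_simps)
  show "{w (i + k), w (i + 1 + k)} \<in> E" for i
    using cyclic_walkD(4)[OF assms, of "i + k"] by (simp add: algebra_simps)
qed (use cyclic_walkD(1)[OF assms] in auto)

lemma cyclic_walk_reflect:
  assumes "cyclic_walk E L w"
  shows "cyclic_walk E L (\<lambda>i. w (- i))"
  unfolding cyclic_walk_def
proof (intro conjI allI)
  show "inj_on (\<lambda>i. w (- i)) {0..<int L}"
  proof (rule inj_onI)
    fix i j assume ij: "i \<in> {0..<int L}" "j \<in> {0..<int L}" "w (- i) = w (- j)"
    then have "(- i) mod int L = (- j) mod int L" using cyclic_walk_eq_iff[OF assms] by simp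
    then have "int L dvd j - i" by (simp add: mod_eq_dvd_iff)
    then have "j mod int L = i mod int L" by (simp add: mod_eq_dvd_iff)
    then show "i = j" using ij by simp
  qed
  show "w (- (i + int L)) = w (- i)" for i
    using cyclic_walkD(3)[OF assms, of "- i - int L"] by (simp add: algebra_simps)
  show "{w (- i), w (- (i + 1))} \<in> E" for i
    using cyclic_walkD(4)[OF assms, of "- i - 1"] by (simp add: insert_commute)
qed (use cyclic_walkD(1)[OF assms] in auto)

lemma successively_nth:
  "successively P xs \<Longrightarrow> Suc i < length xs \<Longrightarrow> P (xs ! i) (xs ! Suc i)"
proof (induction P xs arbitrary: i rule: successively.induct)
  case (3 P x y xs)
  then show ?case by (cases i) auto
qed auto

lemma graph_cycleI:
  assumes "3 \<le> length p" "distinct p" "successively (\<lambda>x y. {x, y} \<in> E) p" "{last p, hd p} \<in> E"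
  shows "graph_cycle E p"
  unfolding graph_cycle_def
proof (intro conjI allI impI)
  fix i assume i: "i < length p"
  show "{p ! i, p ! (Suc i mod length p)} \<in> E"
  proof (cases "Suc i = length p")
    case True
    then have "i = length p - 1" by simp
    moreover have "p \<noteq> []" using assms(1) by auto
    ultimately show ?thesis using True assms(4) by (simp add: last_conv_nth hd_conv_nth)
  next
    case False
    then show ?thesis using i successively_nth[OF assms(3), of i] by simp
  qed
qed (use assms in auto)

lemma graph_cycle_cyclic_walk:
  assumes "graph_cycle E p"
  shows "cyclic_walk E (length p) (\<lambda>i. p ! nat (i mod int (length p)))"
proof -
  define L where "L = length p"
  have L: "3 \<le> L" "distinct p" "\<And>i. i < L \<Longrightarrow> {p ! i, p ! (Suc i mod L)} \<in> E"
    using assms by (auto simp: graph_cycle_def L_def)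
  have "inj_on (\<lambda>i. p ! nat (i mod int L)) {0..<int L}"
    using L by (intro inj_onI) (auto simp: nth_eq_iff_index_eq L_def)
  moreover have "{p ! nat (i mod int L), p ! nat ((i + 1) mod int L)} \<in> E" for i
  proof -
    define k where "k = nat (i mod int L)"
    have k: "int k = i mod int L" "k < L" using L(1) unfolding k_def by (auto simp: nat_less_iff)
    have "(i + 1) mod int L = (int k + 1) mod int L" unfolding k(1) by (simp add: mod_add_left_eq)
    also have "\<dots> = int (Suc k mod L)" by (simp add: zmod_int add.commute)
    finally have "nat ((i + 1) mod int L) = Suc k mod L" by simp
    then show ?thesis using L(3)[OF k(2)] k_def by simp
  qed
  ultimately show ?thesis using L(1) by (auto simp: cyclic_walk_def L_def)
qed

lemma cyclic_walk_cycle_length: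
  assumes "cyclic_walk E L w"
  shows "L \<in> cycle_lengths E"
proof -
  define p where "p = map (\<lambda>i. w (int i)) [0..<L]"
  have "inj_on (\<lambda>i. w (int i)) {0..<L}"
    using inj_onD[OF cyclic_walkD(2)[OF assms]] by (intro inj_onI) force
  then have "distinct p" unfolding p_def by (simp add: distinct_map)
  moreover have "{p ! i, p ! (Suc i mod length p)} \<in> E" if "i < length p" for i
  proof -
    have "w (int (Suc i mod L)) = w (int i + 1)"
      using cyclic_walk_mod[OF assms, of "int i + 1"] by (simp add: zmod_int add.commute)
    then show ?thesis using cyclic_walkD(4)[OF assms, of "int i"] that by (simp add: p_def)
  qed
  ultimately have "graph_cycle E p" using cyclic_walkD(1)[OF assms]
    by (auto simp: graph_cycle_def p_def)
  then show ?thesis unfolding cycle_lengths_def by (auto simp: p_def intro!: exI[of _ p])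
qed

lemma successively_upto:
  "(\<And>i. a \<le> i \<Longrightarrow> i < b \<Longrightarrow> P i (i + 1)) \<Longrightarrow> successively P [a..b]"
proof (induction a b rule: upto.induct)
  case (1 a b)
  show ?case
  proof (cases "a < b")
    case True
    then have "[a..b] = a # (a + 1) # [a + 2..b]" by (simp add: upto.simps)
    moreover have "[a + 1..b] = (a + 1) # [a + 2..b]" using True by (simp add: upto.simps)
    ultimately show ?thesis using 1 True by simp
  next
    case False
    then show ?thesis by (cases "a = b") (auto simp: upto.simps)
  qed
qed

text \<open>Loop erasure: when a step returns to an element already on the list, the list is cut
  back to it.\<close>

lemma rtrancl_distinct_path:
  assumes "(a, b) \<in> r\<^sup>*"
  obtains xs where "xs \<noteq> []" "hd xs = a" "last xs = b" "distinct xs"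
    "successively (\<lambda>x y. (x, y) \<in> r) xs" "set xs \<subseteq> r\<^sup>* `` {a}"
proof -
  have "\<exists>xs. xs \<noteq> [] \<and> hd xs = a \<and> last xs = b \<and> distinct xs \<and>
      successively (\<lambda>x y. (x, y) \<in> r) xs \<and> set xs \<subseteq> r\<^sup>* `` {a}"
    using assms
  proof (induction rule: rtrancl_induct)
    case base
    show ?case by (intro exI[of _ "[a]"]) auto
  next
    case (step b c)
    then obtain xs where xs: "xs \<noteq> []" "hd xs = a" "last xs = b" "distinct xs"
      "successively (\<lambda>x y. (x, y) \<in> r) xs" "set xs \<subseteq> r\<^sup>* `` {a}" by blast
    show ?case
    proof (cases "c \<in> set xs")
      case True
      then obtain ys zs where "xs = ys @ c # zs" by (meson split_list)
      then have "xs = (ys @ [c]) @ zs" by simp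
      then show ?thesis using xs
        by (intro exI[of _ "ys @ [c]"]) (auto simp: successively_append_iff hd_append split: if_splits)
    next
      case False
      have "(a, c) \<in> r\<^sup>*" using step by simp
      then show ?thesis using xs step False
        by (intro exI[of _ "xs @ [c]"]) (auto simp: successively_append_iff)
    qed
  qed
  then show thesis using that by blast
qed

section \<open>Fat triangles contain tight cycles\<close>

text \<open>A jump has both ends in \<open>X\<close>, but the segment between them may leave
  \<open>X\<close>. This suffices, since a chain of jumps changes from one edge to another only at a
  vertex, which is then the end of a jump and lies in \<open>X\<close>.\<close>

definition link :: "'a set set \<Rightarrow> ('a \<Rightarrow> real) set \<Rightarrow> (('a \<Rightarrow> real) \<times> ('a \<Rightarrow> real)) set" where
  "link E X = {(edge_point u v s, edge_point u v t) | u v s t.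
     {u, v} \<in> E \<and> 0 \<le> s \<and> s \<le> 1 \<and> 0 \<le> t \<and> t \<le> 1 \<and> edge_point u v s \<in> X \<and> edge_point u v t \<in> X}"

lemma sym_link: "sym (link E X)"
  unfolding link_def sym_def by blast

context metric_graph
begin

lemma walk_point_cyclic:
  assumes "cyclic_walk E L w"
  shows "walk_point w s \<in> pts" "s \<le> s' \<Longrightarrow> gdist (walk_point w s) (walk_point w s') \<le> s' - s"
    "walk_point w (s + real L) = walk_point w s"
proof -
  note edge = cyclic_walkD(4)[OF assms]
  show "walk_point w s \<in> pts"
    by (rule walk_point_in_pts[of "\<lfloor>s\<rfloor>" "\<lfloor>s\<rfloor> + 1"]) (simp add: edge, simp, simp, linarith)
  show "gdist (walk_point w s) (walk_point w s') \<le> s' - s" if "s \<le> s'"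
    by (rule walk_point_dist_le[of "\<lfloor>s\<rfloor>" "\<lceil>s'\<rceil>"]) (use that edge in auto)
  have "w (i + int L) = w i" for i by (rule cyclic_walkD(3)[OF assms])
  then have "walk_point (\<lambda>i. w (i + int L)) s = walk_point w s" by simp
  then show "walk_point w (s + real L) = walk_point w s" using walk_point_shift[of w "int L" s] by simp
qed

text \<open>The centre is the point at parameter \<open>t\<close>, and
  \<open>[t + D, t + L - D]\<close> is the rest of one period. There only vertices are constrained,
  which is what chains of jumps deliver and what the shortcut estimates use.\<close>

definition tight_cycle :: "real \<Rightarrow> nat \<Rightarrow> (int \<Rightarrow> 'a) \<Rightarrow> real \<Rightarrow> bool" where
  "tight_cycle D L w t \<longleftrightarrow> cyclic_walk E L w \<and>
     (\<forall>s s'. t - D \<le> s \<and> s \<le> s' \<and> s' \<le> t + D \<longrightarrow> gdist (walk_point w s) (walk_point w s') = s' - s) \<and>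
     (\<forall>j. t + D \<le> of_int j \<and> of_int j \<le> t + real L - D \<longrightarrow>
        D \<le> gdist (walk_point w t) (vertex_point (w j)))"

text \<open>The complementary arc of length \<open>L - 2 * D\<close> joins two points at distance
  \<open>2 * D\<close>. If \<open>2 * D\<close> exceeded \<open>L\<close>, the geodesic arc would
  contain \<open>t - D + L\<close>, which is the same point as \<open>t - D\<close>.\<close>

lemma tight_cycle_length:
  assumes "tight_cycle D L w t" "0 < D"
  shows "4 * D \<le> real L"
proof -
  have w: "cyclic_walk E L w" using assms by (simp add: tight_cycle_def)
  note w' = walk_point_cyclic[OF w]
  have iso: "gdist (walk_point w (t - D)) (walk_point w s) = s - (t - D)"
    if "t - D \<le> s" "s \<le> t + D" for s
    using assms that by (simp add: tight_cycle_def)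
  have "2 * D \<le> real L"
    using iso[of "t - D + real L"] w'(3)[of "t - D"] assms cyclic_walkD(1)[OF w] by force
  then have "gdist (walk_point w (t + D)) (walk_point w (t - D + real L)) \<le> real L - 2 * D"
    using w'(2)[of "t + D" "t - D + real L"] by simp
  then show ?thesis using iso[of "t + D"] w'(3)[of "t - D"] assms(2) graph_dist_sym[of E "walk_point w (t + D)"]
    by simp
qed

text \<open>By the triangle inequality no point of the path comes nearer to \<open>p\<close> than
  \<open>gdist p q - l\<close>.\<close>

lemma path_linked:
  assumes "path_length E q q' l" "q \<in> pts" "p \<in> pts" "r + l < gdist p q"
  shows "(q, q') \<in> (link E {z. r < gdist p z})\<^sup>*"
  using assms(1,4)
proof (induction)
  case (step u v s l t)
  have far: "r < gdist p z" if "path_length E q z m" "m \<le> l + \<bar>s - t\<bar>" for z m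
  proof -
    have "gdist p q \<le> gdist p z + gdist z q"
      using path_length_in_pts[OF that(1) assms(2)] assms by (intro graph_dist_triangle)
    moreover have "gdist z q \<le> m" using that(1) graph_dist_le path_length_sym by blast
    ultimately show ?thesis using step.prems that(2) by linarith
  qed
  have "path_length E q (edge_point u v t) (l + \<bar>s - t\<bar>)" using step.hyps by (rule path_length.step)
  then have "r < gdist p (edge_point u v s)" "r < gdist p (edge_point u v t)"
    using far step.hyps(1) by auto
  then have "(edge_point u v s, edge_point u v t) \<in> link E {z. r < gdist p z}"
    using step.hyps unfolding link_def by blast
  moreover have "(q, edge_point u v s) \<in> (link E {z. r < gdist p z})\<^sup>*"
    using step.prems by (intro step.IH) linarith
  ultimately show ?case by (rule rtrancl_into_rtrancl[rotated])
qed simp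

text \<open>A geodesic is just an isometric map, so it is cut into pieces shorter than
  \<open>D - r\<close>, and each is replaced by a genuine path that is also shorter than
  \<open>D - r\<close>. Such a path may come nearer than \<open>D\<close> to \<open>p\<close> but
  not as near as \<open>r\<close>.\<close>

lemma geodesic_linked:
  assumes "p \<in> pts" and r: "r < D"
    and \<gamma>: "\<And>s. a \<le> s \<Longrightarrow> s \<le> b \<Longrightarrow> \<gamma> s \<in> pts \<and> D \<le> gdist p (\<gamma> s)"
    "\<And>s s'. a \<le> s \<Longrightarrow> s \<le> s' \<Longrightarrow> s' \<le> b \<Longrightarrow> gdist (\<gamma> s) (\<gamma> s') = s' - s"
    and "a \<le> b"
  shows "(\<gamma> a, \<gamma> b) \<in> (link E {z. r < gdist p z})\<^sup>*"
proof -
  define \<eta> where "\<eta> = (D - r) / 2"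
  have \<eta>: "0 < \<eta>" using r by (simp add: \<eta>_def)
  have "(\<gamma> a, \<gamma> s) \<in> (link E {z. r < gdist p z})\<^sup>*" if "a \<le> s" "s \<le> b" "s - a \<le> real n * \<eta>" for n s
    using that
  proof (induction n arbitrary: s)
    case (Suc n)
    define s' where "s' = max a (s - \<eta>)"
    have s': "a \<le> s'" "s' \<le> s" "s - s' \<le> \<eta>" "s' - a \<le> real n * \<eta>"
      using Suc.prems \<eta> by (auto simp: s'_def algebra_simps)
    then have IH: "(\<gamma> a, \<gamma> s') \<in> (link E {z. r < gdist p z})\<^sup>*" using Suc by simp
    have "gdist (\<gamma> s') (\<gamma> s) < D - r" using \<gamma>(2)[of s' s] s' Suc.prems \<eta> by (simp add: \<eta>_def)
    then obtain l where l: "path_length E (\<gamma> s') (\<gamma> s) l" "l < D - r"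
      using graph_dist_less_path[of "\<gamma> s'" "\<gamma> s"] \<gamma>(1) s' Suc.prems by auto
    have "\<gamma> s' \<in> pts" "D \<le> gdist p (\<gamma> s')" using \<gamma>(1)[of s'] s' Suc.prems by auto
    then have "(\<gamma> s', \<gamma> s) \<in> (link E {z. r < gdist p z})\<^sup>*"
      using l assms(1) by (intro path_linked[of _ _ l]) auto
    with IH show ?case by (rule rtrancl_trans)
  qed simp
  moreover obtain n :: nat where "b - a \<le> real n * \<eta>"
    using reals_Archimedean3[OF \<eta>] by (meson less_imp_le)
  ultimately show ?thesis using assms(5) by simp
qed

text \<open>If both ends of the edge of \<open>x\<close> were nearer than \<open>D\<close>, the gap
  would put neither beyond \<open>r\<close>, and no jump could land on them. The chain would be
  caught inside this edge, within distance 1 of \<open>x\<close>, and never reach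
  \<open>y\<close>.\<close>

lemma far_end:
  assumes x: "x = edge_point e e' \<beta>" "{e, e'} \<in> E" "0 \<le> \<beta>" "\<beta> < 1" "D \<le> gdist p x" "1 < gdist x y"
    and e': "gdist p (vertex_point e') < D"
    and gap: "\<And>v. v \<in> V \<Longrightarrow> r < gdist p (vertex_point v) \<Longrightarrow> D \<le> gdist p (vertex_point v)"
    and link: "(x, y) \<in> (link E {z. r < gdist p z})\<^sup>*"
  shows "D \<le> gdist p (vertex_point e)"
proof (rule ccontr)
  assume near: "\<not> D \<le> gdist p (vertex_point e)"
  have ne: "e \<noteq> e'" using edge_neq x by blast
  have "e \<in> V" "e' \<in> V" using edge_in_V x by auto
  then have not_far: "\<not> r < gdist p (vertex_point e)" "\<not> r < gdist p (vertex_point e')"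
    using gap near e' by fastforce+
  have "\<exists>s>0. s < 1 \<and> y = edge_point e e' s"
    using link
  proof (induction rule: rtrancl_induct)
    case base
    have "\<beta> \<noteq> 0" using near x by auto
    then show ?case using x by (intro exI[of _ \<beta>]) auto
  next
    case (step q q')
    then obtain s where s: "0 < s" "s < 1" "q = edge_point e e' s" by blast
    from step obtain a b s1 t1 where ab: "{a, b} \<in> E" "0 \<le> t1" "t1 \<le> 1"
      "q = edge_point a b s1" "q' = edge_point a b t1" "r < gdist p q'"
      unfolding link_def by auto
    have "0 < q e" "0 < q e'" using s edge_point_second[OF ne] by auto
    then have "e = a \<or> e = b" "e' = a \<or> e' = b" using ab edge_point_pos_iff by metis+
    then have "a = e \<and> b = e' \<or> a = e' \<and> b = e" using ne by auto
    then have "q' = edge_point e e' t1 \<or> q' = edge_point e e' (1 - t1)"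
      using ab edge_point_swap[of a b t1] edge_neq[OF ab(1)] by auto
    then obtain t where t: "q' = edge_point e e' t" "0 \<le> t" "t \<le> 1"
    proof
      assume "q' = edge_point e e' (1 - t1)"
      then show thesis using that[of "1 - t1"] ab by simp
    qed (use that[of t1] ab in simp)
    have "t \<noteq> 0" using t ab not_far by auto
    moreover have "t \<noteq> 1" using t ab not_far edge_point_1[OF ne] by auto
    ultimately show ?case using t by (intro exI[of _ t]) auto
  qed
  then obtain s where "0 < s" "s < 1" "y = edge_point e e' s" by blast
  then have "gdist x y \<le> \<bar>\<beta> - s\<bar>" using x by (auto intro!: graph_dist_le path_length_edge)
  then show False using x \<open>0 < s\<close> \<open>s < 1\<close> by linarith
qed

text \<open>The inner vertices of the geodesic walk are nearer to \<open>p\<close> than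
  \<open>D\<close>, while the chain yields a vertex path in \<open>F\<close> from
  \<open>w hi\<close> to \<open>w lo\<close>. For this reason the two are disjoint, and they close
  up to a cycle.\<close>

lemma linked_tight_cycle:
  assumes p: "p \<in> pts" and x: "x \<in> pts" and y: "y \<in> pts" and D: "1 < D"
    "gdist p x = D" "gdist p y = D" "gdist x y = 2 * D"
    and link: "\<And>r. r < D \<Longrightarrow> (x, y) \<in> (link E {z. r < gdist p z})\<^sup>*"
  shows "\<exists>L w t. tight_cycle D L w t"
proof -
  obtain w lo hi t where walk: "\<And>i. lo \<le> i \<Longrightarrow> i < hi \<Longrightarrow> {w i, w (i + 1)} \<in> E" and
    lohi: "of_int lo \<le> t - D" "t - D < of_int lo + 1" "of_int hi - 1 < t + D" "t + D \<le> of_int hi" and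
    pxy: "p = walk_point w t" "x = walk_point w (t - D)" "y = walk_point w (t + D)"
    by (rule geodesic_walk_through[OF p x y D]) blast
  have "of_int lo + 2 < (of_int hi :: real)" using lohi D by linarith
  then have hilo: "lo + 2 < hi" by linarith
  have iso: "gdist (walk_point w s) (walk_point w s') = s' - s"
    if "t - D \<le> s" "s \<le> s'" "s' \<le> t + D" for s s'
    using walk_point_isometric[of lo hi w "t - D" "t + D" s s', OF walk] hilo lohi pxy D that by simp
  have inner: "t - D < of_int i" "of_int i < t + D" if "lo < i" "i < hi" for i
  proof -
    have "of_int lo + 1 \<le> (of_int i :: real)" "of_int i \<le> (of_int hi - 1 :: real)" using that by linarith+
    then show "t - D < of_int i" "of_int i < t + D" using lohi by linarith+
  qed
  have near: "gdist p (vertex_point (w i)) < D" if "lo < i" "i < hi" for i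
  proof (cases "t \<le> of_int i")
    case True
    then show ?thesis using iso[of t "of_int i"] inner[OF that] D pxy by simp
  next
    case False
    then show ?thesis using iso[of "of_int i" t] inner[OF that] D pxy
        graph_dist_sym[of E p "vertex_point (w i)"] by simp
  qed
  define F where "F = {v \<in> V. D \<le> gdist p (vertex_point v)}"
  \<comment> \<open>With finitely many vertices, the largest distance of a vertex outside
    \<open>F\<close> is a level below \<open>D\<close> that only vertices of \<open>F\<close>
    exceed. The 0 keeps the set nonempty.\<close>
  obtain r where r: "r < D" "\<And>v. v \<in> V \<Longrightarrow> r < gdist p (vertex_point v) \<Longrightarrow> v \<in> F"
  proof -
    define N where "N = insert 0 ((\<lambda>v. gdist p (vertex_point v)) ` (V - F))"
    have "finite N" using finite_V by (simp add: N_def)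
    moreover from this have "Max N < D" using D by (subst Max_less_iff) (auto simp: N_def F_def)
    ultimately show thesis using that[of "Max N"] Max_ge[of N] unfolding N_def by force
  qed
  let ?X = "{z. r < gdist p z}"
  have gap: "D \<le> gdist p (vertex_point v)" if "v \<in> V" "r < gdist p (vertex_point v)" for v
    using r(2)[OF that] by (simp add: F_def)
  have xy: "(x, y) \<in> (link E ?X)\<^sup>*" by (rule link[OF r(1)])
  then have yx: "(y, x) \<in> (link E ?X)\<^sup>*" using sym_rtrancl[OF sym_link, of E ?X] by (meson symD)
  have lo_edge: "{w lo, w (lo + 1)} \<in> E" and hi_edge: "{w hi, w (hi - 1)} \<in> E"
    using walk[of lo] walk[of "hi - 1"] hilo by (auto simp: insert_commute)
  have x_eq: "x = edge_point (w lo) (w (lo + 1)) (t - D - of_int lo)"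
    using pxy walk_point_edge[of lo "t - D" w] lohi edge_neq[OF lo_edge] by simp
  have "y = edge_point (w (hi - 1)) (w hi) (t + D - of_int (hi - 1))"
    using pxy walk_point_edge[of "hi - 1" "t + D" w] lohi edge_neq[OF hi_edge] by simp
  also have "t + D - of_int (hi - 1) = 1 - (of_int hi - (t + D))" by simp
  also have "edge_point (w (hi - 1)) (w hi) \<dots> = edge_point (w hi) (w (hi - 1)) (of_int hi - (t + D))"
    by (rule edge_point_swap[OF edge_neq[OF hi_edge], symmetric])
  finally have y_eq: "y = edge_point (w hi) (w (hi - 1)) (of_int hi - (t + D))" .
  have "D \<le> gdist p (vertex_point (w lo))"
    by (rule far_end[OF x_eq lo_edge _ _ _ _ _ gap xy]) (use lohi D near[of "lo + 1"] hilo in auto)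
  then have lo_F: "w lo \<in> F" using edge_in_V[OF lo_edge] by (simp add: F_def)
  have "D \<le> gdist p (vertex_point (w hi))"
    by (rule far_end[OF y_eq hi_edge _ _ _ _ _ gap yx])
      (use lohi D near[of "hi - 1"] hilo graph_dist_sym[of E x y] in auto)
  then have hi_F: "w hi \<in> F" using edge_in_V[OF hi_edge] by (simp add: F_def)
  define R where "R = {(a, b). {a, b} \<in> E \<and> a \<in> F \<and> b \<in> F}"
  have R_F: "a \<in> F" if "(w hi, a) \<in> R\<^sup>*" for a
    using that hi_F by (induction rule: rtrancl_induct) (auto simp: R_def)
  \<comment> \<open>Followed from \<open>y\<close> to \<open>x\<close>, the chain drags a vertex
    along: the current point always has positive coordinate at some vertex reached inside
    \<open>F\<close>. That vertex has to change only when a jump lands on the opposite end of the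
    edge, and this end is in \<open>F\<close> by the choice of \<open>r\<close>.\<close>
  have "\<exists>a. (w hi, a) \<in> R\<^sup>* \<and> 0 < x a"
    using yx
  proof (induction rule: rtrancl_induct)
    case base
    show ?case using y_eq lohi by (intro exI[of _ "w hi"]) auto
  next
    case (step q q')
    then obtain a where a: "(w hi, a) \<in> R\<^sup>*" "0 < q a" by blast
    from step obtain u v s1 t1 where uv: "{u, v} \<in> E" "0 \<le> t1" "t1 \<le> 1"
      "q = edge_point u v s1" "q' = edge_point u v t1" "r < gdist p q'"
      unfolding link_def by auto
    have au: "a = u \<or> a = v" using a uv edge_point_pos_iff by metis
    show ?case
    proof (cases "0 < q' a")
      case False
      have "\<exists>b. {a, b} \<in> E \<and> q' = vertex_point b"
        using au
      proof
        assume "a = u"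
        then have "t1 = 1" using False uv by auto
        then have "q' = vertex_point v" using uv edge_point_1[OF edge_neq[OF uv(1)]] by simp
        then show ?thesis using \<open>a = u\<close> uv(1) by blast
      next
        assume "a = v"
        then have "t1 = 0" using False uv edge_point_second[OF edge_neq[OF uv(1)]] by auto
        then show ?thesis using \<open>a = v\<close> uv by (auto simp: insert_commute intro!: exI[of _ u])
      qed
      then obtain b where b: "{a, b} \<in> E" "q' = vertex_point b" by blast
      then have "b \<in> F" using r(2)[of b] uv(6) edge_in_V[OF b(1)] by simp
      then have "(a, b) \<in> R" using R_F[OF a(1)] b(1) by (simp add: R_def)
      then have "(w hi, b) \<in> R\<^sup>*" using a(1) by simp
      then show ?thesis using b by (intro exI[of _ b]) auto
    qed (use a in blast)
  qed
  then obtain a where a: "(w hi, a) \<in> R\<^sup>*" "0 < x a" by blast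
  have "a = w lo \<or> a = w (lo + 1)" using a(2) unfolding x_eq by (rule edge_point_pos_iff)
  moreover have "a \<noteq> w (lo + 1)" using R_F[OF a(1)] near[of "lo + 1"] hilo by (auto simp: F_def)
  ultimately have "(w hi, w lo) \<in> R\<^sup>*" using a by simp
  then obtain fs where fs: "fs \<noteq> []" "hd fs = w hi" "last fs = w lo" "distinct fs"
    "successively (\<lambda>x y. (x, y) \<in> R) fs" "set fs \<subseteq> R\<^sup>* `` {w hi}"
    by (rule rtrancl_distinct_path)
  have fs_F: "set fs \<subseteq> F" using fs(6) R_F by auto
  define ks where "ks = [lo + 1..hi - 1]"
  define z where "z = map w ks @ fs"
  define L where "L = length z"
  have len_ks: "int (length ks) = hi - lo - 1" "ks \<noteq> []" using hilo by (auto simp: ks_def)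
  have len: "int L = hi - lo - 1 + int (length fs)" using len_ks by (simp add: L_def z_def)
  have "graph_cycle E z"
  proof (rule graph_cycleI)
    show "3 \<le> length z" using len hilo fs(1) unfolding L_def by (cases fs) auto
    have "inj_on w (set ks)"
    proof (rule linorder_inj_onI)
      fix i j assume "i < j" "i \<in> set ks" "j \<in> set ks"
      then have "gdist (walk_point w (of_int i)) (walk_point w (of_int j)) = of_int j - of_int i"
        using inner[of i] inner[of j] by (intro iso) (auto simp: ks_def)
      then show "w i \<noteq> w j" using \<open>i < j\<close> by auto
    qed auto
    moreover have "w i \<notin> F" if "i \<in> set ks" for i
      using near[of i] that by (auto simp: ks_def F_def)
    ultimately show "distinct z" using fs(4) fs_F by (auto simp: z_def distinct_map ks_def)
    have "successively (\<lambda>x y. {x, y} \<in> E) fs"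
      using fs(5) by (rule successively_mono) (auto simp: R_def)
    moreover have "successively (\<lambda>x y. {x, y} \<in> E) (map w ks)"
      unfolding successively_map ks_def using walk by (intro successively_upto) auto
    moreover have "last ks = hi - 1"
      using hilo unfolding ks_def by (simp add: upto_rec2)
    ultimately show "successively (\<lambda>x y. {x, y} \<in> E) z"
      using len_ks fs(1,2) hi_edge by (auto simp: z_def successively_append_iff last_map insert_commute)
    have "hd ks = lo + 1" using hilo unfolding ks_def by (simp add: upto_rec1)
    then show "{last z, hd z} \<in> E" using fs(1,3) len_ks lo_edge by (simp add: z_def hd_map)
  qed
  then have cyc: "cyclic_walk E L (\<lambda>i. z ! nat (i mod int L))"
    unfolding L_def by (rule graph_cycle_cyclic_walk)
  \<comment> \<open>The list \<open>z\<close> begins with \<open>w (lo + 1)\<close>. After this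
    shift \<open>W\<close> agrees with \<open>w\<close> from \<open>lo\<close> to \<open>hi\<close>,
    so the parameter \<open>t\<close> still denotes \<open>p\<close>.\<close>
  define W where "W i = z ! nat ((i + (- (lo + 1))) mod int L)" for i
  have W: "cyclic_walk E L W" unfolding W_def by (rule cyclic_walk_shift[OF cyc])
  have L0: "0 < L" using cyclic_walkD(1)[OF W] by simp
  have W_fs: "W i = fs ! nat (i - hi)" if "hi \<le> i" "i \<le> lo + int L" for i
  proof -
    have "(i + (- (lo + 1))) mod int L = i - lo - 1" using that hilo by (subst mod_pos_pos_trivial) auto
    then have "W i = z ! nat (i - lo - 1)" by (simp add: W_def)
    also have "nat (i - lo - 1) = length (map w ks) + nat (i - hi)" using that len_ks by simp
    finally show ?thesis by (simp add: z_def nth_append)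
  qed
  have W_w: "W i = w i" if i: "lo \<le> i" "i \<le> hi" for i
  proof -
    consider "i = lo" | "lo < i" "i < hi" | "i = hi" using i by linarith
    then show ?thesis
    proof cases
      case 1
      have "W lo = W (lo + int L)" using cyclic_walkD(3)[OF W] by simp
      also have "\<dots> = fs ! nat (lo + int L - hi)" using W_fs[of "lo + int L"] len fs(1) by (cases fs) auto
      also have "nat (lo + int L - hi) = length fs - 1" using len by simp
      finally show ?thesis using 1 fs(1,3) by (simp add: last_conv_nth)
    next
      case 2
      then have "(i + (- (lo + 1))) mod int L = i - lo - 1" using len by (subst mod_pos_pos_trivial) auto
      then have "W i = z ! nat (i - lo - 1)" by (simp add: W_def)
      also have "\<dots> = w (ks ! nat (i - lo - 1))"
      proof -
        have "nat (i - lo - 1) < length ks" using 2 len_ks by linarith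
        then show ?thesis by (simp add: z_def nth_append)
      qed
      also have "ks ! nat (i - lo - 1) = i" using 2 unfolding ks_def by (subst nth_upto) auto
      finally show ?thesis .
    next
      case 3
      then show ?thesis using W_fs[of hi] len fs(1,2) by (cases fs) auto
    qed
  qed
  have W_point: "walk_point W s = walk_point w s" if "t - D \<le> s" "s \<le> t + D" for s
    by (rule walk_point_cong[of lo hi]) (use W_w lohi that in auto)
  have "D \<le> gdist (walk_point W t) (vertex_point (W j))"
    if j: "t + D \<le> of_int j" "of_int j \<le> t + real L - D" for j
  proof -
    have "of_int hi - 1 < (of_int j :: real)" "of_int j < (of_int (lo + int L + 1) :: real)"
      using j lohi by auto
    then have "hi \<le> j" "j \<le> lo + int L" by linarith+
    moreover from this have "nat (j - hi) < length fs" using len by linarith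
    ultimately have "W j \<in> F" using W_fs[of j] fs_F by (auto simp: subset_iff)
    then show ?thesis using W_point[of t] D pxy by (simp add: F_def)
  qed
  then have "tight_cycle D L W t" unfolding tight_cycle_def using W iso W_point by auto
  then show ?thesis by blast
qed

text \<open>Since \<open>x\<close> lies on \<open>C\<close> and \<open>y\<close> on
  \<open>B\<close>, the point \<open>p\<close> is farther than \<open>D\<close> from both ends of
  \<open>A\<close>, so \<open>A\<close> has points at \<open>\<tau> - D\<close> and
  \<open>\<tau> + D\<close>. They are joined along \<open>A\<close> to \<open>x\<close>, along
  \<open>C\<close> to \<open>z\<close>, along \<open>B\<close> to \<open>y\<close> and back along
  \<open>A\<close>.\<close>

lemma fat_triangle_tight_cycle:
  assumes T: "geodesic_triangle V E (A, B, C)" and "p \<in> A"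
    and far: "\<And>q. q \<in> B \<union> C \<Longrightarrow> D < gdist p q" and D: "1 < D"
  shows "\<exists>L w t. tight_cycle D L w t"
proof -
  from T obtain x y z where xyz: "x \<in> pts" "y \<in> pts" "z \<in> pts" and
    geo: "geodesic V E x y A" "geodesic V E y z B" "geodesic V E z x C"
    unfolding geodesic_triangle_def by auto
  obtain \<alpha> where \<alpha>: "\<alpha> ` {0..gdist x y} = A" "A \<subseteq> pts" "\<alpha> 0 = x" "\<alpha> (gdist x y) = y"
    "\<And>s t. s \<in> {0..gdist x y} \<Longrightarrow> t \<in> {0..gdist x y} \<Longrightarrow> gdist (\<alpha> s) (\<alpha> t) = \<bar>s - t\<bar>"
    using geo(1) unfolding geodesic_def by blast
  have side: "(u, v) \<in> (link E {z. r < gdist p z})\<^sup>*" "u \<in> S" "v \<in> S"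
    if S: "geodesic V E u v S" "S \<subseteq> B \<union> C" "u \<in> pts" "v \<in> pts" and r: "r < D" for u v S r
  proof -
    obtain \<gamma> where \<gamma>: "\<gamma> ` {0..gdist u v} = S" "S \<subseteq> pts" "\<gamma> 0 = u" "\<gamma> (gdist u v) = v"
      "\<And>s t. s \<in> {0..gdist u v} \<Longrightarrow> t \<in> {0..gdist u v} \<Longrightarrow> gdist (\<gamma> s) (\<gamma> t) = \<bar>s - t\<bar>"
      using S(1) unfolding geodesic_def by blast
    have in_S: "\<gamma> s \<in> S" if "0 \<le> s" "s \<le> gdist u v" for s
      using that unfolding \<gamma>(1)[symmetric] by simp
    have p: "p \<in> pts" using \<open>p \<in> A\<close> \<alpha>(2) by blast
    have "(\<gamma> 0, \<gamma> (gdist u v)) \<in> (link E {z. r < gdist p z})\<^sup>*"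
    proof (rule geodesic_linked[OF p r])
      show "\<gamma> s \<in> pts \<and> D \<le> gdist p (\<gamma> s)" if "0 \<le> s" "s \<le> gdist u v" for s
        using in_S[OF that] \<gamma>(2) S(2) far[of "\<gamma> s"] by (auto simp: subset_iff)
      show "gdist (\<gamma> s) (\<gamma> s') = s' - s" if "0 \<le> s" "s \<le> s'" "s' \<le> gdist u v" for s s'
        using \<gamma>(5)[of s s'] that by simp
      show "0 \<le> gdist u v" using graph_dist_nonneg S by simp
    qed
    then show "(u, v) \<in> (link E {z. r < gdist p z})\<^sup>*" using \<gamma> by simp
    show "u \<in> S" "v \<in> S" using in_S[of 0] in_S[of "gdist u v"] \<gamma> graph_dist_nonneg S by auto
  qed
  obtain \<tau> where \<tau>: "0 \<le> \<tau>" "\<tau> \<le> gdist x y" "p = \<alpha> \<tau>" using \<open>p \<in> A\<close> unfolding \<alpha>(1)[symmetric] by auto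
  have dist: "gdist (\<alpha> s) (\<alpha> s') = \<bar>s - s'\<bar>" if "0 \<le> s" "s \<le> gdist x y" "0 \<le> s'" "s' \<le> gdist x y" for s s'
    using \<alpha>(5) that by simp
  have in_pts: "\<alpha> s \<in> pts" if "0 \<le> s" "s \<le> gdist x y" for s
    using \<alpha>(1,2) that by auto
  have "x \<in> C" "y \<in> B" using side[OF geo(3)] side[OF geo(2)] xyz D by auto
  then have "D < gdist p x" "D < gdist p y" using far by auto
  then have \<tau>D: "0 < \<tau> - D" "\<tau> + D < gdist x y"
    using dist[of \<tau> 0] dist[of \<tau> "gdist x y"] \<tau> \<alpha>(3,4) by auto
  have link_A: "(\<alpha> a, \<alpha> b) \<in> (link E {z. r < gdist p z})\<^sup>*"
    if "r < D" "0 \<le> a" "a \<le> b" "b \<le> gdist x y" "b \<le> \<tau> - D \<or> \<tau> + D \<le> a" for r a b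
  proof (rule geodesic_linked)
    show "\<alpha> s \<in> pts \<and> D \<le> gdist p (\<alpha> s)" if "a \<le> s" "s \<le> b" for s
      using in_pts[of s] dist[of \<tau> s] \<tau> that \<open>0 \<le> a\<close> \<open>b \<le> gdist x y\<close> \<open>b \<le> \<tau> - D \<or> \<tau> + D \<le> a\<close> by auto
    show "gdist (\<alpha> s) (\<alpha> s') = s' - s" if "a \<le> s" "s \<le> s'" "s' \<le> b" for s s'
      using dist[of s s'] that \<open>0 \<le> a\<close> \<open>b \<le> gdist x y\<close> by auto
  qed (use that \<tau> in_pts in auto)
  show ?thesis
  proof (rule linked_tight_cycle[of p "\<alpha> (\<tau> - D)" "\<alpha> (\<tau> + D)" D])
    show "gdist p (\<alpha> (\<tau> - D)) = D" "gdist p (\<alpha> (\<tau> + D)) = D" "gdist (\<alpha> (\<tau> - D)) (\<alpha> (\<tau> + D)) = 2 * D"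
      using dist[of \<tau> "\<tau> - D"] dist[of \<tau> "\<tau> + D"] dist[of "\<tau> - D" "\<tau> + D"] \<tau> \<tau>D D by auto
    show "(\<alpha> (\<tau> - D), \<alpha> (\<tau> + D)) \<in> (link E {z. r < gdist p z})\<^sup>*" if r: "r < D" for r
    proof -
      note sym = symD[OF sym_rtrancl[OF sym_link]]
      have "(\<alpha> (\<tau> - D), x) \<in> (link E {z. r < gdist p z})\<^sup>*"
        using sym[OF link_A[OF r, of 0 "\<tau> - D"]] \<alpha>(3) \<tau>D \<tau> D by auto
      moreover have "(x, z) \<in> (link E {z. r < gdist p z})\<^sup>*"
        using sym[OF side(1)[OF geo(3)]] xyz r by auto
      moreover have "(z, y) \<in> (link E {z. r < gdist p z})\<^sup>*"
        using sym[OF side(1)[OF geo(2)]] xyz r by auto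
      moreover have "(y, \<alpha> (\<tau> + D)) \<in> (link E {z. r < gdist p z})\<^sup>*"
        using sym[OF link_A[OF r, of "\<tau> + D" "gdist x y"]] \<alpha>(4) \<tau>D \<tau> D by auto
      ultimately show ?thesis by (meson rtrancl_trans)
    qed
  qed (use in_pts \<tau> \<tau>D D in auto)
qed

end

section \<open>Bounding the hyperbolicity constant\<close>

context metric_graph
begin

lemma triangle_thin:
  assumes T: "geodesic_triangle V E (A, B, C)" and D: "1 < D" "\<And>L w t. \<not> tight_cycle D L w t"
  shows "in_nbhd E D A (B \<union> C)" "in_nbhd E D B (C \<union> A)" "in_nbhd E D C (A \<union> B)"
proof -
  have side: "in_nbhd E D A (B \<union> C)" if T: "geodesic_triangle V E (A, B, C)" for A B C
    unfolding in_nbhd_def using fat_triangle_tight_cycle[OF T _ _ D(1)] D(2) by (meson not_le)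
  have "geodesic_triangle V E (B, C, A)" "geodesic_triangle V E (C, A, B)"
    using T unfolding geodesic_triangle_def by blast+
  then show "in_nbhd E D A (B \<union> C)" "in_nbhd E D B (C \<union> A)" "in_nbhd E D C (A \<union> B)"
    using side T by blast+
qed

lemma triangle_delta_le:
  assumes T: "geodesic_triangle V E T" and "1 \<le> r"
    and thin: "\<And>D L w t. r < D \<Longrightarrow> \<not> tight_cycle D L w t"
  shows "triangle_delta E T \<le> r"
proof (rule field_le_epsilon)
  fix e :: real assume e: "0 < e"
  obtain A B C where ABC: "T = (A, B, C)" by (cases T)
  have "r + e \<in> {r. 0 \<le> r \<and> in_nbhd E r A (B \<union> C) \<and> in_nbhd E r B (C \<union> A) \<and> in_nbhd E r C (A \<union> B)}"
    using triangle_thin[of A B C "r + e"] T thin[of "r + e"] ABC \<open>1 \<le> r\<close> e by simp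
  then show "triangle_delta E T \<le> r + e"
    unfolding triangle_delta_def ABC by (auto intro!: cInf_lower bdd_belowI[of _ 0])
qed

lemma geodesic_refl: "x \<in> pts \<Longrightarrow> geodesic V E x x {x}"
  unfolding geodesic_def by (intro exI[of _ "\<lambda>_. x"]) auto

lemma hyp_const_le:
  assumes "1 \<le> r" "\<And>D L w t. r < D \<Longrightarrow> \<not> tight_cycle D L w t"
  shows "hyp_const V E \<le> r"
proof -
  obtain u where "u \<in> V" using connected by (auto simp: connected_graph_def)
  then have "geodesic V E (vertex_point u) (vertex_point u) {vertex_point u}" "vertex_point u \<in> pts"
    by (auto intro: geodesic_refl vertex_in_pts)
  then have "geodesic_triangle V E ({vertex_point u}, {vertex_point u}, {vertex_point u})"
    unfolding geodesic_triangle_def by auto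
  then have "{triangle_delta E T |T. geodesic_triangle V E T} \<noteq> {}" by blast
  moreover have "triangle_delta E T \<le> r" if "geodesic_triangle V E T" for T
    using triangle_delta_le[OF that] assms by blast
  ultimately show ?thesis unfolding hyp_const_def by (intro cSup_least) blast+
qed

lemma cyclic_walk_le_card:
  assumes "cyclic_walk E L w"
  shows "L \<le> card V"
proof -
  have "card {0..<int L} \<le> card V"
    using cyclic_walkD[OF assms] edge_in_V finite_V by (intro card_inj_on_le[of w]) auto
  then show ?thesis by simp
qed

lemma finite_cycle_lengths: "finite (cycle_lengths E)"
proof (rule finite_subset)
  show "cycle_lengths E \<subseteq> {..card V}"
    unfolding cycle_lengths_def using cyclic_walk_le_card graph_cycle_cyclic_walk by blast
qed simp

lemma tight_cycle_le_card:
  assumes "tight_cycle D L w t" "0 < D"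
  shows "4 * D \<le> real (card V)"
  using tight_cycle_length[OF assms] cyclic_walk_le_card[of L w] assms(1)
  by (simp add: tight_cycle_def)

lemma hyp_const_le_circumference:
  assumes "4 \<le> circumference E"
  shows "hyp_const V E \<le> real (circumference E) / 4"
proof (rule hyp_const_le)
  show "\<not> tight_cycle D L w t" if "real (circumference E) / 4 < D" for D L w t
  proof
    assume tight: "tight_cycle D L w t"
    then have "L \<le> circumference E"
      unfolding circumference_def tight_cycle_def
      using cyclic_walk_cycle_length finite_cycle_lengths by (intro Max_ge) auto
    then show False using tight_cycle_length[OF tight] that by simp
  qed
qed (use assms in simp)

lemma hyp_const_ge:
  assumes T: "geodesic_triangle V E (A, B, C)" and "p \<in> A" "0 \<le> r"
    and far: "\<And>q. q \<in> B \<union> C \<Longrightarrow> r \<le> gdist p q"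
  shows "r \<le> hyp_const V E"
proof -
  \<comment> \<open>A crude bound from \<open>4 * D <= L <= card V\<close>. It makes the supremum
    range over a bounded set and the infimum over a nonempty one.\<close>
  define R where "R = max 1 (real (card V))"
  have R: "\<not> tight_cycle D L w t" if "R < D" for D L w t
    using tight_cycle_le_card[of D L w t] that by (auto simp: R_def)
  have le: "triangle_delta E T \<le> R" if "geodesic_triangle V E T" for T
    by (rule triangle_delta_le[OF that]) (auto simp: R_def dest: tight_cycle_le_card)
  have "\<exists>s. 0 \<le> s \<and> in_nbhd E s A (B \<union> C) \<and> in_nbhd E s B (C \<union> A) \<and> in_nbhd E s C (A \<union> B)"
    using triangle_thin[OF T, of "R + 1"] R[of "R + 1"]
    by (intro exI[of _ "R + 1"]) (simp add: R_def)
  moreover have "r \<le> s" if "in_nbhd E s A (B \<union> C)" for s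
    using that \<open>p \<in> A\<close> far unfolding in_nbhd_def by fastforce
  ultimately have "r \<le> triangle_delta E (A, B, C)"
    unfolding triangle_delta_def by (auto intro!: cInf_greatest)
  also have "\<dots> \<le> hyp_const V E"
    unfolding hyp_const_def using T le by (intro cSup_upper) (auto intro!: bdd_aboveI[of _ R])
  finally show ?thesis .
qed

section \<open>A shortest cycle is isometric\<close>

text \<open>\<open>d < L\<close> makes the arc from \<open>w a\<close> to \<open>w (a + d)\<close>
  injective, and the way back along \<open>g\<close> meets the cycle at its two ends only.\<close>

lemma shortcut_cycle:
  assumes w: "cyclic_walk E L w" and g: "g 0 = w (a + int d)" "g n = w a" "1 \<le> n" "n < d" "d < L"
    "\<And>i. i < n \<Longrightarrow> {g i, g (Suc i)} \<in> E" "inj_on g {0..n}"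
    and avoid: "\<And>i j. 0 < i \<Longrightarrow> i < n \<Longrightarrow> g i \<noteq> w j"
  shows "d + n \<in> cycle_lengths E"
proof -
  define z where "z = map w [a..a + int d] @ map g [1..<n]"
  have len: "length z = d + n" using g by (simp add: z_def)
  have "graph_cycle E z"
  proof (rule graph_cycleI)
    show "3 \<le> length z" using g len by simp
    have "inj_on w {a..a + int d}"
    proof (rule inj_onI)
      fix i j assume "i \<in> {a..a + int d}" "j \<in> {a..a + int d}" "w i = w j"
      then have "int L dvd i - j" "\<bar>i - j\<bar> < int L"
        using cyclic_walk_eq_iff[OF w, of i j] g by (auto simp: mod_eq_dvd_iff)
      then show "i = j" using zdvd_imp_le[of "int L" "\<bar>i - j\<bar>"] by fastforce
    qed
    moreover have "inj_on g {1..<n}" using g(7) by (rule inj_on_subset) auto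
    moreover have "w i \<noteq> g j" if "1 \<le> j" "j < n" for i j using avoid[of j i] that by simp
    ultimately show "distinct z" by (fastforce simp: z_def distinct_map)
    have "successively (\<lambda>x y. {x, y} \<in> E) (map w [a..a + int d])"
      unfolding successively_map using cyclic_walkD(4)[OF w] by (intro successively_upto)
    moreover have "successively (\<lambda>x y. {x, y} \<in> E) (map g [1..<n])"
    proof -
      have "map int [1..<n] = [1..int n - 1]"
        by (rule nth_equalityI) (auto simp: nth_upto)
      then have "[1..<n] = map nat [1..int n - 1]" by (metis list.map_comp map_idI nat_int comp_apply)
      then show ?thesis using g(6)
        by (auto simp: successively_map nat_add_distrib intro!: successively_upto)
    qed
    moreover have "last [a..a + int d] = a + int d" "hd [a..a + int d] = a"
      by (simp add: upto_rec2, simp add: upto_rec1)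
    moreover have "n \<noteq> 1 \<longrightarrow> {w (a + int d), g 1} \<in> E" "{g (n - 1), w a} \<in> E"
      using g(1,2,3) g(6)[of 0] g(6)[of "n - 1"] by auto
    ultimately show "successively (\<lambda>x y. {x, y} \<in> E) z" "{last z, hd z} \<in> E"
      using g(1,3) unfolding z_def
      by (cases "n = 1"; auto simp: successively_append_iff last_map hd_map hd_append last_append)+
  qed
  then show ?thesis unfolding cycle_lengths_def using len by force
qed

text \<open>Strong induction on \<open>n\<close>, the conclusion being a bound on the cyclic
  distance of \<open>i\<close> and \<open>j\<close>. A walk that beats this distance cannot meet the
  cycle in between, as the induction hypothesis would apply to both parts, nor repeat a vertex, as
  it could be shortened. Closed by the shorter arc, which is longer than the walk, it gives a cycle
  of less than twice that arc, hence shorter than \<open>L\<close>.\<close>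

lemma shortest_cycle_relpow:
  assumes w: "cyclic_walk E L w" and shortest: "\<And>m. m \<in> cycle_lengths E \<Longrightarrow> L \<le> m"
    and "(w i, w j) \<in> adj E ^^ n"
  shows "\<exists>k. \<bar>i - j + k * int L\<bar> \<le> int n"
  using assms(3)
proof (induction n arbitrary: i j rule: less_induct)
  case (less n)
  obtain f where f: "f 0 = w i" "f n = w j" "\<And>m. m < n \<Longrightarrow> {f m, f (Suc m)} \<in> E"
    using less.prems unfolding relpow_fun_conv by auto
  have segment: "(f a, f (a + m)) \<in> adj E ^^ m" if "a + m \<le> n" for a m
    unfolding relpow_fun_conv using f(3) that by (intro exI[of _ "\<lambda>i. f (a + i)"]) auto
  show ?case
  proof (rule ccontr)
    assume "\<not> ?thesis"
    then have far: "int n < \<bar>i - j + k * int L\<bar>" for k by (simp add: not_le)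
    have "i mod int L \<noteq> j mod int L"
    proof
      assume "i mod int L = j mod int L"
      then obtain k where "i - j = int L * k" by (auto simp: mod_eq_dvd_iff dvd_def)
      then show False using far[of "- k"] by (simp add: algebra_simps)
    qed
    then have "w i \<noteq> w j" using cyclic_walk_eq_iff[OF w] by simp
    then have n: "1 \<le> n" using f by (cases n) auto
    have avoid: "f m \<noteq> w l" if m: "0 < m" "m < n" for m l
    proof
      assume eq: "f m = w l"
      have "(w i, w l) \<in> adj E ^^ m" "(w l, w j) \<in> adj E ^^ (n - m)"
        using segment[of 0 m] segment[of m "n - m"] f m eq by auto
      then obtain k k' where "\<bar>i - l + k * int L\<bar> \<le> int m" "\<bar>l - j + k' * int L\<bar> \<le> int (n - m)"
        using less.IH[of m i l] less.IH[of "n - m" l j] m by auto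
      then show False using far[of "k + k'"] m by (simp add: algebra_simps)
    qed
    have inj: "inj_on f {0..n}"
    proof (rule linorder_inj_onI)
      fix a b assume ab: "a < b" "a \<in> {0..n}" "b \<in> {0..n}"
      show "f a \<noteq> f b"
      proof
        assume eq: "f a = f b"
        have "(w i, f a) \<in> adj E ^^ a" "(f a, w j) \<in> adj E ^^ (n - b)"
          using segment[of 0 a] segment[of b "n - b"] f ab eq by auto
        then have "(w i, w j) \<in> adj E ^^ (a + (n - b))" unfolding relpow_add by blast
        moreover have "a + (n - b) < n" using ab by auto
        ultimately obtain k where "\<bar>i - j + k * int L\<bar> \<le> int (a + (n - b))"
          using less.IH by blast
        then show False using far[of k] ab by simp
      qed
    qed auto
    have L: "0 < L" using cyclic_walkD(1)[OF w] by simp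
    define d where "d = nat ((j - i) mod int L)"
    have d: "int d = (j - i) mod int L" "d < L" using L by (auto simp: d_def nat_less_iff)
    define q where "q = (j - i) div int L"
    have ji: "j = i + int d + q * int L" unfolding d(1) q_def by (simp add: algebra_simps)
    \<comment> \<open>The multiples \<open>q\<close> and \<open>q + 1\<close> of \<open>L\<close>
      turn \<open>far\<close> into a comparison with the two arcs between \<open>w i\<close> and
      \<open>w j\<close>, of lengths \<open>d\<close> and \<open>L - d\<close>.\<close>
    have nd: "n < d" using far[of q] ji by simp
    have nd': "n < L - d" using far[of "q + 1"] ji d(2) by (simp add: algebra_simps)
    show False
    proof (cases "2 * d \<le> L")
      case True
      have "d + n \<in> cycle_lengths E"
      proof (rule shortcut_cycle[OF w, of "\<lambda>m. f (n - m)" i])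
        show "f (n - 0) = w (i + int d)" using f(2) ji cyclic_walk_add_mult[OF w] by simp
        show "{f (n - m), f (n - Suc m)} \<in> E" if "m < n" for m
          using f(3)[of "n - Suc m"] that by (simp add: Suc_diff_Suc insert_commute)
        show "inj_on (\<lambda>m. f (n - m)) {0..n}"
        proof (rule inj_onI)
          fix k l assume "k \<in> {0..n}" "l \<in> {0..n}" "f (n - k) = f (n - l)"
          moreover from this have "n - k = n - l" by (intro inj_onD[OF inj]) auto
          ultimately show "k = l" by auto
        qed
      qed (use f n nd d avoid in auto)
      then show False using shortest[of "d + n"] nd True by simp
    next
      case False
      have "(L - d) + n \<in> cycle_lengths E"
      proof (rule shortcut_cycle[OF w, of f j])
        have "j + int (L - d) = i + (q + 1) * int L" using ji d(2) by (simp add: algebra_simps)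
        then show "f 0 = w (j + int (L - d))" using f(1) cyclic_walk_add_mult[OF w] by simp
      qed (use f n nd nd' d avoid inj in auto)
      then show False using shortest[of "(L - d) + n"] nd' nd False d by linarith
    qed
  qed
qed

lemma walk_point_pos:
  assumes "cyclic_walk E L w" "0 < walk_point w s u"
  obtains i where "u = w i" "1 - walk_point w s u = \<bar>s - of_int i\<bar>"
proof -
  have ne: "w \<lfloor>s\<rfloor> \<noteq> w (\<lfloor>s\<rfloor> + 1)" using cyclic_walkD(4)[OF assms(1)] edge_neq by blast
  have "u = w \<lfloor>s\<rfloor> \<or> u = w (\<lfloor>s\<rfloor> + 1)"
    using assms(2) unfolding walk_point_def by (rule edge_point_pos_iff)
  then show ?thesis
  proof
    assume "u = w \<lfloor>s\<rfloor>"
    then show ?thesis using that[of "\<lfloor>s\<rfloor>"] by (simp add: walk_point_def)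
  next
    assume u: "u = w (\<lfloor>s\<rfloor> + 1)"
    have "s \<le> of_int \<lfloor>s\<rfloor> + 1" by linarith
    then show ?thesis using that[of "\<lfloor>s\<rfloor> + 1"] u edge_point_second[OF ne] by (simp add: walk_point_def)
  qed
qed

lemma walk_point_interior:
  assumes w: "cyclic_walk E L w" and x: "walk_point w s = edge_point a b r" "0 < r" "r < 1" "a \<noteq> b"
  shows "a = w \<lfloor>s\<rfloor> \<and> b = w (\<lfloor>s\<rfloor> + 1) \<and> r = s - of_int \<lfloor>s\<rfloor> \<or>
    a = w (\<lfloor>s\<rfloor> + 1) \<and> b = w \<lfloor>s\<rfloor> \<and> r = 1 - (s - of_int \<lfloor>s\<rfloor>)"
proof -
  have ne: "w \<lfloor>s\<rfloor> \<noteq> w (\<lfloor>s\<rfloor> + 1)" using cyclic_walkD(4)[OF w] edge_neq by blast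
  have eq: "edge_point (w \<lfloor>s\<rfloor>) (w (\<lfloor>s\<rfloor> + 1)) (s - of_int \<lfloor>s\<rfloor>) = edge_point a b r"
    using x by (simp add: walk_point_def)
  have b: "edge_point a b r b = r" using x edge_point_second by metis
  have "0 < edge_point a b r a" "0 < edge_point a b r b" using x b by auto
  then have "a = w \<lfloor>s\<rfloor> \<or> a = w (\<lfloor>s\<rfloor> + 1)" "b = w \<lfloor>s\<rfloor> \<or> b = w (\<lfloor>s\<rfloor> + 1)"
    unfolding eq[symmetric] by (auto dest: edge_point_pos_iff)
  then show ?thesis
    using x(4) arg_cong[OF eq, of "\<lambda>f. f b"] b edge_point_second[OF ne] by auto
qed

lemma shortest_cycle_isometric:
  assumes w: "cyclic_walk E L w" and shortest: "\<And>m. m \<in> cycle_lengths E \<Longrightarrow> L \<le> m"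
    and s: "s \<le> s'" "s' - s \<le> real L / 2"
  shows "gdist (walk_point w s) (walk_point w s') = s' - s"
proof (rule antisym)
  show "gdist (walk_point w s) (walk_point w s') \<le> s' - s" using walk_point_cyclic(2)[OF w] s by simp
  have far: "s' - s \<le> \<bar>s - s' + of_int (k * int L)\<bar>" for k
  proof (cases "k = 0")
    case False
    then have "1 * int L \<le> \<bar>k\<bar> * int L" by (intro mult_right_mono) auto
    then have "int L \<le> \<bar>k * int L\<bar>" by (simp add: abs_mult)
    then have "real L \<le> \<bar>of_int (k * int L)\<bar>" by linarith
    then show ?thesis using s by linarith
  qed (use s in simp)
  show "s' - s \<le> gdist (walk_point w s) (walk_point w s')"
    using walk_point_cyclic(1)[OF w, of s] walk_point_cyclic(1)[OF w, of s']
  proof (cases rule: graph_dist_cases)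
    case (walk u v n)
    obtain i where i: "u = w i" "1 - walk_point w s u = \<bar>s - of_int i\<bar>"
      using walk_point_pos[OF w walk(1)] by blast
    obtain j where j: "v = w j" "1 - walk_point w s' v = \<bar>s' - of_int j\<bar>"
      using walk_point_pos[OF w walk(2)] by blast
    obtain k where "\<bar>i - j + k * int L\<bar> \<le> int n"
      using shortest_cycle_relpow[OF w shortest] walk(3) i j by blast
    then have "\<bar>of_int i - of_int j + of_int (k * int L)\<bar> \<le> real n" by linarith
    then show ?thesis using far[of k] walk(4) i j by linarith
  next
    case (edge a b r r')
    have ab: "a \<noteq> b" using edge_neq edge by blast
    define i j where "i = \<lfloor>s\<rfloor>" and "j = \<lfloor>s'\<rfloor>"
    note x = walk_point_interior[OF w edge(6,2,3) ab, folded i_def]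
    note y = walk_point_interior[OF w edge(7,4,5) ab, folded j_def]
    \<comment> \<open>Both points lie inside one edge. If the cycle ran through it in opposite
      directions at \<open>s\<close> and at \<open>s'\<close>, then \<open>L\<close> would divide
      2.\<close>
    have "w (i + 1) = w j \<longrightarrow> w i \<noteq> w (j + 1)"
    proof (intro impI notI)
      assume "w (i + 1) = w j" "w i = w (j + 1)"
      then have "int L dvd i + 1 - j" "int L dvd j + 1 - i"
        using cyclic_walk_eq_iff[OF w] by (metis mod_eq_dvd_iff)+
      then have "int L dvd (i + 1 - j) + (j + 1 - i)" by (rule dvd_add)
      then have "int L dvd 2" by simp
      then show False using cyclic_walkD(1)[OF w] zdvd_imp_le[of "int L" 2] by simp
    qed
    then have ij: "w i = w j \<and> \<bar>r - r'\<bar> = \<bar>(s - of_int i) - (s' - of_int j)\<bar>" using x y by auto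
    then have "int L dvd j - i" using cyclic_walk_eq_iff[OF w] by (metis mod_eq_dvd_iff)
    then obtain k where "j - i = k * int L" by (auto simp: dvd_def mult.commute)
    then have "of_int j - of_int i = (of_int (k * int L) :: real)" by linarith
    then show ?thesis using far[of k] ij edge(8) by linarith
  qed
qed

lemma shortest_cycle_le_hyp_const:
  assumes w: "cyclic_walk E L w" and shortest: "\<And>m. m \<in> cycle_lengths E \<Longrightarrow> L \<le> m"
  shows "real L / 4 \<le> hyp_const V E"
proof -
  define h where "h = real L / 2"
  define x y where "x = walk_point w 0" and "y = walk_point w h"
  note iso = shortest_cycle_isometric[OF w shortest]
  note in_pts = walk_point_cyclic(1)[OF w]
  have period: "walk_point w (2 * h) = x"
    using walk_point_cyclic(3)[OF w, of 0] by (simp add: h_def x_def)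
  have h: "0 \<le> h" by (simp add: h_def)
  have arc: "geodesic V E (walk_point w a) (walk_point w (a + h)) (walk_point w ` {a..a + h})" for a
  proof -
    have "gdist (walk_point w a) (walk_point w (a + h)) = h" using iso[of a "a + h"] by (simp add: h_def)
    moreover have "(\<lambda>s. walk_point w (a + s)) ` {0..h} = walk_point w ` {a..a + h}"
      using image_image[of "walk_point w" "\<lambda>s. a + s" "{0..h}"] by (simp add: image_add_atLeastAtMost add.commute)
    moreover have "gdist (walk_point w (a + s)) (walk_point w (a + s')) = \<bar>s - s'\<bar>"
      if "s \<in> {0..h}" "s' \<in> {0..h}" for s s'
      using iso[of "a + s" "a + s'"] iso[of "a + s'" "a + s"] that
        graph_dist_sym[of E "walk_point w (a + s)"] by (cases "s \<le> s'") (auto simp: h_def)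
    ultimately show ?thesis
      unfolding geodesic_def using in_pts by (intro exI[of _ "\<lambda>s. walk_point w (a + s)"]) auto
  qed
  \<comment> \<open>A bigon, recorded as a triangle whose third side is the single point
    \<open>x\<close>.\<close>
  have "geodesic_triangle V E (walk_point w ` {0..h}, walk_point w ` {h..2 * h}, {x})"
    unfolding geodesic_triangle_def case_prod_conv
  proof (intro bexI conjI)
    show "geodesic V E x y (walk_point w ` {0..h})" using arc[of 0] by (simp add: x_def y_def)
    show "geodesic V E y x (walk_point w ` {h..2 * h})" using arc[of h] period by (simp add: y_def)
  qed (use in_pts geodesic_refl in \<open>auto simp: x_def y_def\<close>)
  moreover have "real L / 4 \<le> gdist (walk_point w (h / 2)) q"
    if "q \<in> walk_point w ` {h..2 * h} \<union> {x}" for q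
  proof -
    have "x \<in> walk_point w ` {h..2 * h}" unfolding period[symmetric] using h by auto
    then have "q \<in> walk_point w ` {h..2 * h}" using that by auto
    then obtain s where s: "q = walk_point w s" "h \<le> s" "s \<le> 2 * h" by auto
    show ?thesis
    \<comment> \<open>\<open>3 * h / 2\<close> is antipodal to \<open>h / 2\<close>; beyond it the
      shorter way runs in the other direction and is measured from \<open>s - 2 * h\<close>.\<close>
    proof (cases "s \<le> 3 * h / 2")
      case True
      then show ?thesis using iso[of "h / 2" s] s h by (simp add: h_def)
    next
      case False
      have "q = walk_point w (s - 2 * h)"
        using walk_point_cyclic(3)[OF w, of "s - 2 * h"] s by (simp add: h_def)
      then show ?thesis using iso[of "s - 2 * h" "h / 2"] s h False
          graph_dist_sym[of E q] by (simp add: h_def)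
    qed
  qed
  moreover have "walk_point w (h / 2) \<in> walk_point w ` {0..h}" using h by auto
  ultimately show ?thesis by (intro hyp_const_ge) auto
qed

end

section \<open>Tight cycles with shortcuts\<close>

lemma walk_point_reflect:
  assumes "\<And>i. w i \<noteq> w (i + 1)"
  shows "walk_point (\<lambda>i. w (- i)) s = walk_point w (- s)"
proof (cases "s = of_int \<lfloor>s\<rfloor>")
  case True
  then have "walk_point (\<lambda>i. w (- i)) s = vertex_point (w (- \<lfloor>s\<rfloor>))" by (metis walk_point_int)
  moreover have "walk_point w (- s) = vertex_point (w (- \<lfloor>s\<rfloor>))" using True by (metis of_int_minus walk_point_int)
  ultimately show ?thesis by simp
next
  case False
  define i where "i = - \<lfloor>s\<rfloor> - 1"
  have "of_int i \<le> - s" "- s \<le> of_int i + 1" unfolding i_def by (simp, linarith, simp)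
  then have "walk_point w (- s) = edge_point (w i) (w (i + 1)) (- s - of_int i)"
    using assms by (rule walk_point_edge)
  also have "\<dots> = edge_point (w (i + 1)) (w i) (1 - (- s - of_int i))"
    by (rule edge_point_swap) (rule assms)
  also have "\<dots> = walk_point (\<lambda>i. w (- i)) s"
  proof -
    have "i + 1 = - \<lfloor>s\<rfloor>" "i = - (\<lfloor>s\<rfloor> + 1)" "1 - (- s - of_int i) = s - of_int \<lfloor>s\<rfloor>"
      by (simp_all add: i_def)
    then show ?thesis unfolding walk_point_def by metis
  qed
  finally show ?thesis by simp
qed

context metric_graph
begin

lemma tight_cycle_isometric:
  assumes "tight_cycle D L w t" "t - D \<le> s" "s \<le> s'" "s' \<le> t + D"
  shows "gdist (walk_point w s) (walk_point w s') = s' - s"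
  using assms by (simp add: tight_cycle_def)

lemma tight_cycle_shift:
  assumes "tight_cycle D L w t"
  shows "tight_cycle D L (\<lambda>i. w (i + k)) (t - of_int k)"
  unfolding tight_cycle_def
proof (intro conjI allI impI)
  show "cyclic_walk E L (\<lambda>i. w (i + k))"
    using assms unfolding tight_cycle_def by (intro cyclic_walk_shift) simp
  show "gdist (walk_point (\<lambda>i. w (i + k)) s) (walk_point (\<lambda>i. w (i + k)) s') = s' - s"
    if "t - of_int k - D \<le> s \<and> s \<le> s' \<and> s' \<le> t - of_int k + D" for s s'
  proof -
    have "gdist (walk_point w (s + of_int k)) (walk_point w (s' + of_int k)) = s' + of_int k - (s + of_int k)"
      using that by (intro tight_cycle_isometric[OF assms]) auto
    then show ?thesis by (simp add: walk_point_shift)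
  qed
  show "D \<le> gdist (walk_point (\<lambda>i. w (i + k)) (t - of_int k)) (vertex_point (w (j + k)))"
    if "t - of_int k + D \<le> of_int j \<and> of_int j \<le> t - of_int k + real L - D" for j
  proof -
    have "t + D \<le> of_int (j + k)" "of_int (j + k) \<le> t + real L - D" using that by auto
    then show ?thesis using assms unfolding tight_cycle_def walk_point_shift by simp
  qed
qed

lemma tight_cycle_reflect:
  assumes tight: "tight_cycle D L w t"
  shows "tight_cycle D L (\<lambda>i. w (- i)) (- t)"
  unfolding tight_cycle_def
proof (intro conjI allI impI)
  have w: "cyclic_walk E L w" using tight by (simp add: tight_cycle_def)
  then show "cyclic_walk E L (\<lambda>i. w (- i))" by (rule cyclic_walk_reflect)
  have "w i \<noteq> w (i + 1)" for i using cyclic_walkD(4)[OF w] edge_neq by blast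
  note reflect = walk_point_reflect[of w, OF this]
  show "gdist (walk_point (\<lambda>i. w (- i)) s) (walk_point (\<lambda>i. w (- i)) s') = s' - s"
    if "- t - D \<le> s \<and> s \<le> s' \<and> s' \<le> - t + D" for s s'
  proof -
    have "gdist (walk_point w (- s')) (walk_point w (- s)) = - s - - s'"
      using tight that unfolding tight_cycle_def by auto
    then show ?thesis unfolding reflect by (simp add: graph_dist_sym)
  qed
  show "D \<le> gdist (walk_point (\<lambda>i. w (- i)) (- t)) (vertex_point (w (- j)))"
    if "- t + D \<le> of_int j \<and> of_int j \<le> - t + real L - D" for j
  proof -
    have "D \<le> gdist (walk_point w t) (vertex_point (w (- j + int L)))"
      using tight that unfolding tight_cycle_def by auto
    then show ?thesis unfolding reflect using cyclic_walkD(3)[OF w, of "- j"] by simp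
  qed
qed

text \<open>The route from \<open>t - D\<close> back to \<open>i\<close>, over the shortcut to
  \<open>j\<close> and back to \<open>t + D\<close> has length at most
  \<open>j - i - 2 * D + q\<close>, and it joins two points at distance
  \<open>2 * D\<close>.\<close>

lemma tight_cycle_inside:
  assumes tight: "tight_cycle D L w t" and "0 < D"
    and ij: "of_int i + D \<le> t" "t + D \<le> of_int j"
      "gdist (walk_point w (of_int i)) (walk_point w (of_int j)) \<le> q"
  shows "4 * D \<le> of_int (j - i) + q"
proof -
  have w: "cyclic_walk E L w" using tight by (simp add: tight_cycle_def)
  define d where "d s s' = gdist (walk_point w s) (walk_point w s')" for s s'
  have tri: "d s s'' \<le> d s s' + d s' s''" for s s' s''
    unfolding d_def using walk_point_cyclic(1)[OF w] by (intro graph_dist_triangle)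
  have "d (of_int i) (t - D) \<le> t - D - of_int i" "d (t + D) (of_int j) \<le> of_int j - (t + D)"
    using ij unfolding d_def by (intro walk_point_cyclic(2)[OF w]; simp)+
  then have "d (t - D) (of_int i) \<le> t - D - of_int i" "d (of_int j) (t + D) \<le> of_int j - (t + D)"
    unfolding d_def by (simp_all add: graph_dist_sym)
  moreover have "d (t - D) (t + D) = 2 * D" using tight \<open>0 < D\<close> unfolding tight_cycle_def d_def by simp
  moreover have "d (of_int i) (of_int j) \<le> q" using ij(3) by (simp add: d_def)
  ultimately show ?thesis
    using tri[of "t - D" "t + D" "of_int i"] tri[of "of_int i" "t + D" "of_int j"] by simp
qed

text \<open>If both ends of the chord lie outside the open geodesic arc,
  \<open>tight_cycle_inside\<close> applies; if both lie inside, the chord contradicts that the arc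
  is geodesic. The mixed case is \<open>core\<close>, used a second time after a reflection.\<close>

lemma tight_cycle_chord:
  assumes tight: "tight_cycle D L w t" and "0 < D" and t: "of_int i \<le> t" "t \<le> of_int j"
    and chord: "{w i, w j} \<in> E" and ij: "2 \<le> j - i" "j - i + 1 < int L"
  shows "4 * D \<le> of_int (j - i) + 3"
proof -
  have core: "4 * D \<le> of_int (j - i) + 3"
    if tight: "tight_cycle D L w t" and t: "of_int i \<le> t" "t < of_int i + D" "t + D \<le> of_int j"
      and chord: "{w i, w j} \<in> E" and ij: "j - i + 1 < int L" for w t i j
  proof -
    have w: "cyclic_walk E L w" using tight by (simp add: tight_cycle_def)
    define d where "d s s' = gdist (walk_point w s) (walk_point w s')" for s s'
    have tri: "d s s'' \<le> d s s' + d s' s''" for s s' s''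
      unfolding d_def using walk_point_cyclic(1)[OF w] by (intro graph_dist_triangle)
    have le: "d s s' \<le> \<bar>s - s'\<bar>" for s s'
      unfolding d_def using walk_point_cyclic(2)[OF w, of s s'] walk_point_cyclic(2)[OF w, of s' s]
        graph_dist_sym[of E "walk_point w s"] by (cases "s \<le> s'") auto
    have iso: "d s s' = s' - s" if "t - D \<le> s" "s \<le> s'" "s' \<le> t + D" for s s'
      using tight that unfolding tight_cycle_def d_def by auto
    have ij1: "d (of_int i) (of_int j) \<le> 1" unfolding d_def using dist_adjacent[OF chord] by simp
    have long: "t + D - of_int i \<le> 1 + (of_int j - (t + D))"
      using iso[of "of_int i" "t + D"] tri[of "of_int i" "t + D" "of_int j"] ij1
        le[of "of_int j" "t + D"] t \<open>0 < D\<close> by simp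
    \<comment> \<open>Otherwise \<open>j - L\<close> lies on the geodesic arc more than one step
      before \<open>i\<close>, although the chord makes these vertices adjacent. Hence
      \<open>w j\<close> is one of the far vertices.\<close>
    have "of_int j \<le> t + real L - D"
    proof (rule ccontr)
      assume "\<not> ?thesis"
      moreover have "of_int (j - int L) + 1 < (of_int i :: real)"
        using ij by linarith
      ultimately have "d (of_int (j - int L)) (of_int i) = of_int i - of_int (j - int L)"
        using t by (intro iso) auto
      moreover have "d (of_int (j - int L)) (of_int i) \<le> 1"
        using ij1 cyclic_walkD(3)[OF w, of "j - int L"] unfolding d_def walk_point_int
        by (simp add: graph_dist_sym)
      ultimately show False using ij by linarith
    qed
    then have "D \<le> d t (of_int j)" using tight t unfolding tight_cycle_def d_def by auto
    also have "\<dots> \<le> (t - of_int i) + 1" using tri[of t "of_int j" "of_int i"] le[of t "of_int i"] ij1 t by simp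
    \<comment> \<open>\<open>long\<close> plus twice \<open>D <= t - i + 1\<close> eliminates
      \<open>t\<close>.\<close>
    finally show ?thesis using long by simp
  qed
  have w: "cyclic_walk E L w" using tight by (simp add: tight_cycle_def)
  consider "of_int i + D \<le> t" "t + D \<le> of_int j" | "t < of_int i + D" "of_int j < t + D"
    | "t < of_int i + D" "t + D \<le> of_int j" | "of_int i + D \<le> t" "of_int j < t + D" by linarith
  then show ?thesis
  proof cases
    case 1
    then show ?thesis using tight_cycle_inside[OF tight, of i j 1] dist_adjacent[OF chord] \<open>0 < D\<close> by simp
  next
    case 2
    then have "gdist (walk_point w (of_int i)) (walk_point w (of_int j)) = of_int j - of_int i"
      using t ij by (intro tight_cycle_isometric[OF tight]) auto
    then show ?thesis using dist_adjacent[OF chord] ij by simp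
  next
    case 3
    then show ?thesis using core[OF tight, of i j] t chord ij by simp
  next
    case 4
    then show ?thesis using core[OF tight_cycle_reflect[OF tight], of "- j" "- i"] t chord ij
      by (simp add: insert_commute)
  qed
qed

text \<open>Same scheme as for a chord, with a shortcut of length 2 over \<open>w l\<close>. If
  \<open>w l\<close> is a far vertex it plays the part that the other end of the chord had; the new
  case is that \<open>w l\<close> lies on the geodesic arc, seen from the other side.\<close>

lemma tight_cycle_detour:
  assumes tight: "tight_cycle D L w t" and "0 < D" and t: "of_int i \<le> t" "t \<le> of_int j"
    and detour: "{w i, w l} \<in> E" "{w l, w j} \<in> E" "j < l" "l < i + int L"
    and ij: "3 \<le> j - i" "j - i + 2 < int L"
  shows "4 * D \<le> of_int (j - i) + 4"
proof -
  have core: "4 * D \<le> of_int (j - i) + 4"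
    if tight: "tight_cycle D L w t" and t: "of_int i \<le> t" "t < of_int i + D" "t + D \<le> of_int j"
      and detour: "{w i, w l} \<in> E" "{w l, w j} \<in> E" "j < l" "l < i + int L"
      and ij: "j - i + 2 < int L" for w t i j l
  proof -
    have w: "cyclic_walk E L w" using tight by (simp add: tight_cycle_def)
    define d where "d s s' = gdist (walk_point w s) (walk_point w s')" for s s'
    have tri: "d s s'' \<le> d s s' + d s' s''" for s s' s''
      unfolding d_def using walk_point_cyclic(1)[OF w] by (intro graph_dist_triangle)
    have sym: "d s s' = d s' s" for s s' unfolding d_def by (rule graph_dist_sym)
    have le: "d s s' \<le> \<bar>s - s'\<bar>" for s s'
      using walk_point_cyclic(2)[OF w, of s s'] walk_point_cyclic(2)[OF w, of s' s] sym[of s s']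
      by (cases "s \<le> s'") (auto simp: d_def)
    have iso: "d s s' = s' - s" if "t - D \<le> s" "s \<le> s'" "s' \<le> t + D" for s s'
      using tight that unfolding tight_cycle_def d_def by auto
    have far: "D \<le> d t (of_int m)" if "t + D \<le> of_int m" "of_int m \<le> t + real L - D" for m
      using tight that unfolding tight_cycle_def d_def by auto
    have period: "d (of_int (m - int L)) s = d (of_int m) s" for m s
      using cyclic_walkD(3)[OF w, of "m - int L"] unfolding d_def walk_point_int by simp
    have il: "d (of_int i) (of_int l) \<le> 1" and lj: "d (of_int l) (of_int j) \<le> 1"
      unfolding d_def using dist_adjacent detour by simp_all
    have ti: "d t (of_int i) \<le> t - of_int i" and jD: "d (of_int j) (t + D) \<le> of_int j - (t + D)"
      using le[of t "of_int i"] le[of "of_int j" "t + D"] t by auto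
    have jl: "of_int j + 1 \<le> (of_int l :: real)" using detour by linarith
    show ?thesis
    proof (cases "of_int l \<le> t + real L - D")
      case True
      then have "D \<le> d t (of_int l)" using far[of l] jl t by simp
      then have "D \<le> t - of_int i + 1" using tri[of t "of_int l" "of_int i"] ti il by linarith
      moreover have "t + D - of_int i \<le> 2 + (of_int j - (t + D))"
        using iso[of "of_int i" "t + D"] tri[of "of_int i" "t + D" "of_int l"]
          tri[of "of_int l" "t + D" "of_int j"] il lj jD t \<open>0 < D\<close> by simp
      ultimately show ?thesis by simp
    next
      case False
      \<comment> \<open>Here \<open>l - L\<close> is on the geodesic arc and adjacent to
        \<open>i\<close>, so it directly precedes \<open>i\<close>. The far vertex is now
        \<open>w j\<close>, two steps from \<open>w i\<close> instead of one; in exchange the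
        geodesic starts one edge earlier and uses only one edge of the detour, which improves
        \<open>long\<close> by 2 and balances the doubled extra step.\<close>
      have "of_int (l - int L) + 1 \<le> (of_int i :: real)" using detour by linarith
      then have "d (of_int (l - int L)) (of_int i) = of_int i - of_int (l - int L)"
        using False t by (intro iso) auto
      then have "of_int i - of_int (l - int L) \<le> (1::real)" using period[of l] il sym by metis
      then have l: "l = i + int L - 1" using detour by linarith
      then have "d (of_int (l - int L)) (t + D) = t + D - of_int (l - int L)"
        using False t \<open>0 < D\<close> by (intro iso) auto
      then have "t + D - of_int (l - int L) \<le> 1 + (of_int j - (t + D))"
        using period[of l "t + D"] tri[of "of_int l" "t + D" "of_int j"] lj jD by linarith
      then have long: "t + D - of_int i + 1 \<le> 1 + (of_int j - (t + D))" using l by simp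
      have "of_int j \<le> t + real L - D"
      proof (rule ccontr)
        assume not: "\<not> ?thesis"
        have "of_int (j - int L) \<le> (of_int (l - int L) :: real)" "of_int (l - int L) \<le> (of_int i :: real)"
          using detour by linarith+
        then have "d (of_int (j - int L)) (of_int (l - int L)) = of_int (l - int L) - of_int (j - int L)"
          using not t by (intro iso) auto
        moreover have "d (of_int (j - int L)) (of_int (l - int L)) = d (of_int j) (of_int l)"
          using period sym by metis
        ultimately have "l \<le> j + 1" using lj sym[of "of_int j"] by simp
        then show False using l ij by simp
      qed
      then have "D \<le> d t (of_int j)" using far[of j] t by simp
      then have "D \<le> t - of_int i + 2"
        using tri[of t "of_int j" "of_int i"] tri[of "of_int i" "of_int j" "of_int l"] ti il lj by linarith
      then show ?thesis using long by simp
    qed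
  qed
  have w: "cyclic_walk E L w" using tight by (simp add: tight_cycle_def)
  have two: "gdist (walk_point w (of_int i)) (walk_point w (of_int j)) \<le> 2"
    using dist_adjacent[OF detour(1)] dist_adjacent[OF detour(2)]
      graph_dist_triangle[of "vertex_point (w i)" "vertex_point (w l)" "vertex_point (w j)"]
      edge_in_V[OF detour(1)] edge_in_V[OF detour(2)] vertex_in_pts by simp
  consider "of_int i + D \<le> t" "t + D \<le> of_int j" | "t < of_int i + D" "of_int j < t + D"
    | "t < of_int i + D" "t + D \<le> of_int j" | "of_int i + D \<le> t" "of_int j < t + D" by linarith
  then show ?thesis
  proof cases
    case 1
    then show ?thesis using tight_cycle_inside[OF tight, of i j 2] two \<open>0 < D\<close> by simp
  next
    case 2
    then have "gdist (walk_point w (of_int i)) (walk_point w (of_int j)) = of_int j - of_int i"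
      using t ij by (intro tight_cycle_isometric[OF tight]) auto
    then show ?thesis using two ij by simp
  next
    case 3
    then show ?thesis using core[OF tight, of i j l] t detour ij by simp
  next
    case 4
    have "w (- (int L - l)) = w l" using cyclic_walkD(3)[OF w, of "l - int L"] by simp
    with 4 show ?thesis
      using core[OF tight_cycle_reflect[OF tight], of "- j" "- i" "int L - l"] t detour ij
      by (simp add: insert_commute)
  qed
qed

end

section \<open>Fans\<close>

text \<open>The path \<open>1, \<dots>, c - 1\<close>, whose vertices in \<open>S\<close> are joined to the apex \<open>0\<close>, together with
  the pendant vertices \<open>c, \<dots>, n - 1\<close> at the apex. Each pair of consecutive elements \<open>a < b\<close> of
  \<open>S\<close> bounds a cell, a cycle of length \<open>b - a + 2\<close>.\<close>

definition fan :: "nat \<Rightarrow> nat \<Rightarrow> nat set \<Rightarrow> nat set set" where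
  "fan c n S = {{i, i + 1} | i. 1 \<le> i \<and> i + 1 < c} \<union> {{0, i} | i. i \<in> S \<or> c \<le> i \<and> i < n}"

lemma fan_edge_iff:
  "{i, j} \<in> fan c n S \<longleftrightarrow> 1 \<le> i \<and> j = i + 1 \<and> j < c \<or> 1 \<le> j \<and> i = j + 1 \<and> i < c \<or>
     i = 0 \<and> (j \<in> S \<or> c \<le> j \<and> j < n) \<or> j = 0 \<and> (i \<in> S \<or> c \<le> i \<and> i < n)"
  by (auto simp: fan_def doubleton_eq_iff)

text \<open>\<open>S\<close> is the set of spokes. \<open>S_ends\<close> yields the Hamiltonian
  cycle on \<open>0, ..., c - 1\<close>, \<open>S_gap\<close> and \<open>S_girth\<close> fix the
  girth, and \<open>S_cell\<close> puts every edge of the path on a cycle through the apex of length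
  at most \<open>M\<close>.\<close>

locale fan_graph =
  fixes g M c n :: nat and S :: "nat set"
  assumes g: "5 \<le> g" and gM: "g \<le> M" and cn: "c \<le> n"
    and S_range: "\<And>a. a \<in> S \<Longrightarrow> 1 \<le> a \<and> a < c"
    and S_ends: "1 \<in> S" "c - 1 \<in> S"
    and S_gap: "\<And>a b. a \<in> S \<Longrightarrow> b \<in> S \<Longrightarrow> a < b \<Longrightarrow> a + g \<le> b + 2"
    and S_girth: "\<exists>a\<in>S. a + (g - 2) \<in> S"
    and S_cell: "\<And>x. 1 \<le> x \<Longrightarrow> x + 1 < c \<Longrightarrow> \<exists>a\<in>S. \<exists>b\<in>S. a \<le> x \<and> x < b \<and> b + 2 \<le> a + M"
begin

abbreviation "E \<equiv> fan c n S"

lemma c_large: "g \<le> c" "1 < c - 1"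
proof -
  obtain a where "a \<in> S" "a + (g - 2) \<in> S" using S_girth by blast
  then show "g \<le> c" "1 < c - 1" using S_range[of a] S_range[of "a + (g - 2)"] g by auto
qed

sublocale metric_graph "{..<n}" E
proof
  show "simple_graph {..<n} E"
    unfolding simple_graph_def
  proof (intro conjI ballI)
    fix e assume "e \<in> E"
    then consider i where "e = {i, i + 1}" "i + 1 < c" | i where "e = {0, i}" "i \<in> S \<or> c \<le> i \<and> i < n"
      unfolding fan_def by blast
    then have "e \<subseteq> {..<n} \<and> card e = 2"
    proof cases
      case (2 i)
      then have "0 < i" "i < n" using S_range[of i] S_range[OF S_ends(1)] cn by auto
      then show ?thesis using 2 by simp
    qed (use cn in auto)
    then show "e \<subseteq> {..<n}" "card e = 2" by auto
  qed simp
  have sym: "sym (adj E)" by (auto simp: sym_def insert_commute)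
  have path: "(0, Suc i) \<in> (adj E)\<^sup>*" if "Suc i < c" for i
    using that
  proof (induction i)
    case 0
    then show ?case using S_ends by (auto simp: fan_edge_iff)
  next
    case (Suc i)
    then have "(Suc i, Suc (Suc i)) \<in> adj E" by (auto simp: fan_edge_iff)
    then show ?case using Suc by (auto intro: rtrancl_into_rtrancl)
  qed
  have root: "(0, v) \<in> (adj E)\<^sup>*" if "v < n" for v
  proof -
    consider "v = 0" | "0 < v" "v < c" | "c \<le> v" by linarith
    then show ?thesis
    proof cases
      case 2
      then show ?thesis using path[of "v - 1"] by simp
    next
      case 3
      then have "(0, v) \<in> adj E" using that by (simp add: fan_edge_iff)
      then show ?thesis by blast
    qed simp
  qed
  then have "(u, v) \<in> (adj E)\<^sup>*" if "u < n" "v < n" for u v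
    using that symD[OF sym_rtrancl[OF sym]] by (meson rtrancl_trans)
  moreover have "0 \<in> {..<n}" using c_large cn g by simp
  ultimately show "connected_graph {..<n} E"
    unfolding connected_graph_def by auto
qed

text \<open>Away from the apex only path edges remain, so the largest vertex of the cycle would have
  the same neighbour on both sides and \<open>L\<close> would divide 2.\<close>

lemma fan_cycle_apex:
  assumes w: "cyclic_walk E L w"
  shows "\<exists>k. w k = 0"
proof (rule ccontr)
  assume nz: "\<nexists>k. w k = 0"
  have L: "3 \<le> L" using cyclic_walkD(1)[OF w] .
  have fin: "finite (w ` {0..<int L})" "w ` {0..<int L} \<noteq> {}" using L by auto
  obtain j where j: "w j = Max (w ` {0..<int L})" using Max_in[OF fin] by (metis imageE)
  have "w i \<le> w j" for i
  proof -
    have "w (i mod int L) \<in> w ` {0..<int L}" using L by auto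
    then show ?thesis using Max_ge[OF fin(1)] j cyclic_walk_mod[OF w, of i] by simp
  qed
  then have "w (j + 1) \<le> w j" "w (j - 1) \<le> w j" by auto
  moreover have "w (j + 1) \<noteq> 0" "w (j - 1) \<noteq> 0" "w j \<noteq> 0" using nz by auto
  ultimately have "w j = w (j + 1) + 1" "w j = w (j - 1) + 1"
    using cyclic_walkD(4)[OF w, of j] cyclic_walkD(4)[OF w, of "j - 1"] by (auto simp: fan_edge_iff)
  then have "int L dvd (j + 1) - (j - 1)"
    using cyclic_walk_eq_iff[OF w] by (metis add_right_cancel mod_eq_dvd_iff)
  then show False using L zdvd_imp_le[of "int L" 2] by simp
qed

text \<open>Once it has left the apex the cycle stays on the path, where it moves by single steps
  and cannot turn back without repeating a vertex.\<close>

lemma fan_cycle_monotone: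
  assumes w: "cyclic_walk E L w" and w0: "w 0 = 0"
  shows "w 1 \<in> S" "w (int L - 1) \<in> S"
    "\<exists>\<epsilon>. (\<epsilon> = 1 \<or> \<epsilon> = - 1) \<and> (\<forall>i. 1 \<le> i \<longrightarrow> i < int L \<longrightarrow> int (w i) = int (w 1) + \<epsilon> * (i - 1))"
proof -
  have L: "3 \<le> L" using cyclic_walkD(1)[OF w] .
  have inj: "w i \<noteq> w j" if "0 \<le> i" "i < j" "j < int L" for i j
    using inj_onD[OF cyclic_walkD(2)[OF w], of i j] that by auto
  have nz: "w i \<noteq> 0" if "1 \<le> i" "i < int L" for i using inj[of 0 i] w0 that by simp
  have step: "int (w (i + 1)) = int (w i) + 1 \<or> int (w (i + 1)) = int (w i) - 1" "w i < c" "w (i + 1) < c"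
    if "1 \<le> i" "i + 1 < int L" for i
    using cyclic_walkD(4)[OF w, of i] nz[of i] nz[of "i + 1"] that by (auto simp: fan_edge_iff)
  show "w 1 \<in> S" using cyclic_walkD(4)[OF w, of 0] w0 step(2)[of 1] nz[of 1] L
    by (auto simp: fan_edge_iff)
  have "w (int L) = 0" using cyclic_walkD(3)[OF w, of 0] w0 by simp
  then show "w (int L - 1) \<in> S"
    using cyclic_walkD(4)[OF w, of "int L - 1"] step(3)[of "int L - 2"] nz[of "int L - 1"] L
    by (auto simp: fan_edge_iff)
  define \<epsilon> where "\<epsilon> = int (w 2) - int (w 1)"
  have \<epsilon>: "\<epsilon> = 1 \<or> \<epsilon> = - 1" using step(1)[of 1] L by (auto simp: \<epsilon>_def)
  have lin: "int (w (int k)) = int (w 1) + \<epsilon> * (int k - 1)" if "1 \<le> k" "k < L" for k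
    using that
  proof (induction k rule: less_induct)
    case (less k)
    consider "k = 1" | "k = 2" | "3 \<le> k" using less.prems by linarith
    then show ?case
    proof cases
      case 3
      define i where "i = int k - 1"
      have i: "int (w i) = int (w 1) + \<epsilon> * (i - 1)" "int (w (i - 1)) = int (w 1) + \<epsilon> * (i - 2)"
        using less.IH[of "k - 1"] less.IH[of "k - 2"] 3 less.prems by (auto simp: i_def of_nat_diff)
      have "w (i + 1) \<noteq> w (i - 1)" using inj[of "i - 1" "i + 1"] 3 less.prems by (auto simp: i_def)
      moreover have "int (w (i + 1)) = int (w i) + 1 \<or> int (w (i + 1)) = int (w i) - 1"
        using step(1)[of i] 3 less.prems by (auto simp: i_def)
      ultimately have "int (w (i + 1)) = int (w 1) + \<epsilon> * i" using i \<epsilon> by (auto simp: algebra_simps)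
      then show ?thesis by (simp add: i_def)
    qed (auto simp: \<epsilon>_def)
  qed
  have "int (w i) = int (w 1) + \<epsilon> * (i - 1)" if "1 \<le> i" "i < int L" for i
    using lin[of "nat i"] that by simp
  then show "\<exists>\<epsilon>. (\<epsilon> = 1 \<or> \<epsilon> = - 1) \<and>
      (\<forall>i. 1 \<le> i \<longrightarrow> i < int L \<longrightarrow> int (w i) = int (w 1) + \<epsilon> * (i - 1))"
    using \<epsilon> by blast
qed

text \<open>Normal form of a cycle in a fan, reached by rotation and possibly reflection: it leaves
  the apex by its lower spoke and returns by the upper one.\<close>

definition ascending :: "nat \<Rightarrow> (int \<Rightarrow> nat) \<Rightarrow> bool" where
  "ascending L w \<longleftrightarrow> cyclic_walk E L w \<and> w 0 = 0 \<and> w 1 \<in> S \<and> w (int L - 1) \<in> S \<and>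
     (\<forall>i. 1 \<le> i \<longrightarrow> i < int L \<longrightarrow> int (w i) - int (w 1) = i - 1)"

lemma fan_cycle_ascending:
  assumes w: "cyclic_walk E L w"
  obtains k where "ascending L (\<lambda>i. w (i + k))" | k where "ascending L (\<lambda>i. w (k - i))"
proof -
  obtain k where k: "w k = 0" using fan_cycle_apex[OF w] by blast
  define v where "v i = w (i + k)" for i
  have v: "cyclic_walk E L v" "v 0 = 0"
    using cyclic_walk_shift[OF w] k unfolding v_def by auto
  note mono = fan_cycle_monotone[OF v]
  have L: "3 \<le> L" using cyclic_walkD(1)[OF w] .
  have v_neg: "v (- i) = v (int L - i)" for i using cyclic_walkD(3)[OF v(1), of "- i"] by (simp add: algebra_simps)
  obtain \<epsilon> where \<epsilon>: "\<epsilon> = 1 \<or> \<epsilon> = - 1"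
    "\<And>i. 1 \<le> i \<Longrightarrow> i < int L \<Longrightarrow> int (v i) = int (v 1) + \<epsilon> * (i - 1)"
    using mono(3) by blast
  show thesis
    using \<epsilon>(1)
  proof
    assume "\<epsilon> = 1"
    then have "int (v i) - int (v 1) = i - 1" if "1 \<le> i" "i < int L" for i
      using \<epsilon>(2)[of i] that by simp
    then have "ascending L v" unfolding ascending_def using v mono(1,2) by blast
    then show thesis using that(1)[of k] unfolding v_def by blast
  next
    assume e: "\<epsilon> = - 1"
    have "v (- (int L - 1)) = v 1" using v_neg[of "int L - 1"] by simp
    moreover have "int (v (- i)) - int (v (- 1)) = i - 1" if "1 \<le> i" "i < int L" for i
      using \<epsilon>(2)[of "int L - i"] \<epsilon>(2)[of "int L - 1"] e that L unfolding v_neg by simp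
    ultimately have "ascending L (\<lambda>i. v (- i))"
      unfolding ascending_def using cyclic_walk_reflect[OF v(1)] v(2) mono(1,2) v_neg[of 1] by simp
    then show thesis using that(2)[of k] unfolding v_def by (simp add: algebra_simps)
  qed
qed

lemma cycle_lengths_fan: "cycle_lengths E = {b - a + 2 | a b. a \<in> S \<and> b \<in> S \<and> a < b}"
proof (intro equalityI subsetI)
  fix m assume "m \<in> cycle_lengths E"
  then obtain w where "cyclic_walk E m w"
    unfolding cycle_lengths_def using graph_cycle_cyclic_walk by blast
  then obtain v where v: "ascending m v" by (rule fan_cycle_ascending) auto
  then have "3 \<le> m" using cyclic_walkD(1) unfolding ascending_def by blast
  moreover have "int (v (int m - 1)) - int (v 1) = int m - 1 - 1"
  proof -
    have "1 \<le> int m - 1" "int m - 1 < int m" using \<open>3 \<le> m\<close> by auto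
    then show ?thesis using v unfolding ascending_def by blast
  qed
  ultimately have "m = v (int m - 1) - v 1 + 2" "v 1 < v (int m - 1)" by linarith+
  then show "m \<in> {b - a + 2 | a b. a \<in> S \<and> b \<in> S \<and> a < b}"
    using v unfolding ascending_def by blast
next
  fix m assume "m \<in> {b - a + 2 | a b. a \<in> S \<and> b \<in> S \<and> a < b}"
  then obtain a b where ab: "m = b - a + 2" "a \<in> S" "b \<in> S" "a < b" by blast
  define p where "p = 0 # [a..<b + 1]"
  have "graph_cycle E p"
    unfolding graph_cycle_def
  proof (intro conjI allI impI)
    show "3 \<le> length p" "distinct p" using ab S_range[of a] by (auto simp: p_def)
    show "{p ! i, p ! (Suc i mod length p)} \<in> E" if "i < length p" for i
    proof -
      have "i < b - a + 2" using that ab by (simp add: p_def)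
      then consider "i = 0" | "0 < i" "i \<le> b - a" | "i = b - a + 1" by linarith
      then show ?thesis
      proof cases
        case 1
        then have "p ! i = 0" "p ! (Suc i mod length p) = a"
          using ab by (auto simp: p_def simp del: upt_Suc)
        then show ?thesis using ab by (auto simp: fan_edge_iff)
      next
        case 2
        then have "p ! i = a + i - 1" "p ! (Suc i mod length p) = a + i"
          using ab by (auto simp: p_def nth_Cons' simp del: upt_Suc)
        then show ?thesis using 2 ab S_range[of a] S_range[of b] by (auto simp: fan_edge_iff)
      next
        case 3
        then have "Suc i mod length p = 0" using ab by (simp add: p_def)
        then have "p ! i = b" "p ! (Suc i mod length p) = 0"
          using 3 ab by (auto simp: p_def nth_Cons' simp del: upt_Suc)
        then show ?thesis using ab by (auto simp: fan_edge_iff)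
      qed
    qed
  qed
  moreover have "length p = m" using ab by (simp add: p_def)
  ultimately show "m \<in> cycle_lengths E" unfolding cycle_lengths_def by blast
qed

lemma fan_in_graph_class: "E \<in> graph_class g c n"
proof -
  obtain a where a: "a \<in> S" "a + (g - 2) \<in> S" using S_girth by blast
  then have g_in: "g \<in> cycle_lengths E" using g unfolding cycle_lengths_fan by force
  have "c = (c - 1) - 1 + 2" using c_large g by simp
  then have c_in: "c \<in> cycle_lengths E" using S_ends c_large unfolding cycle_lengths_fan by blast
  have "girth E = g" unfolding girth_def
  proof (rule Min_eqI[OF finite_cycle_lengths _ g_in])
    show "g \<le> m" if "m \<in> cycle_lengths E" for m
      using that S_gap unfolding cycle_lengths_fan by fastforce
  qed
  moreover have "circumference E = c" unfolding circumference_def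
  proof (rule Max_eqI[OF finite_cycle_lengths _ c_in])
    show "m \<le> c" if m: "m \<in> cycle_lengths E" for m
    proof -
      obtain a b where "m = b - a + 2" "a \<in> S" "b \<in> S" "a < b"
        using m unfolding cycle_lengths_fan by blast
      then show ?thesis using S_range[of a] S_range[of b] by simp
    qed
  qed
  ultimately show ?thesis using simple connected g_in by (auto simp: graph_class_def)
qed

text \<open>If the cycle is longer than \<open>M\<close>, the cell over \<open>t\<close> is only
  part of it. A cell at the start or the end of the cycle contains an edge of the cycle at the apex,
  and its other spoke is a chord; a cell in the middle is bridged by its two spokes.\<close>

lemma fan_ascending_tight_cycle:
  assumes asc: "ascending L w" and tight: "tight_cycle D L w t" and "0 < D" and t: "0 \<le> t" "t < real L"
  shows "4 * D \<le> real M + 2"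
proof (cases "L \<le> M")
  case True
  then show ?thesis using tight_cycle_length[OF tight] \<open>0 < D\<close> by simp
next
  case False
  define a b where "a = w 1" and "b = w (int L - 1)"
  have w: "cyclic_walk E L w" "w 0 = 0" "a \<in> S" "b \<in> S"
    using asc unfolding ascending_def a_def b_def by auto
  have w_eq: "int (w i) = int a + i - 1" if "1 \<le> i" "i < int L" for i
  proof -
    have "int (w i) - int a = i - 1" using asc that unfolding ascending_def a_def by blast
    then show ?thesis by simp
  qed
  have L: "3 \<le> L" using cyclic_walkD(1)[OF w(1)] .
  have wL: "w (int L) = 0" using cyclic_walkD(3)[OF w(1), of 0] w(2) by simp
  have b: "int b = int a + int L - 2" using w_eq[of "int L - 1"] L by (simp add: b_def)
  have w_at: "w (int s - int a + 1) = s" if "a \<le> s" "s \<le> b" for s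
    using w_eq[of "int s - int a + 1"] that b by simp
  \<comment> \<open>The cell supplied by \<open>S_cell\<close> may stick out of the cycle. Clipping
    it to \<open>[a, b]\<close> only shortens it and keeps its ends in \<open>S\<close>.\<close>
  have cell: "\<exists>a'\<in>S. \<exists>b'\<in>S. a \<le> a' \<and> a' \<le> x \<and> x < b' \<and> b' \<le> b \<and> b' + 2 \<le> a' + M"
    if x: "a \<le> x" "x < b" for x
  proof -
    have "1 \<le> x" "x + 1 < c" using x S_range[OF w(3)] S_range[OF w(4)] by auto
    from S_cell[OF this] obtain a' b' where "a' \<in> S" "b' \<in> S" "a' \<le> x" "x < b'" "b' + 2 \<le> a' + M"
      by blast
    then show ?thesis using w x
      by (intro bexI[of _ "max a a'"] bexI[of _ "min b b'"]) (auto simp: max_def min_def)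
  qed
  \<comment> \<open>The chord joins the indices 0 and \<open>b' - a + 1\<close>, so the edge from
    the apex to \<open>a\<close> is included. The estimate becomes \<open>b' - a + 4\<close>, the
    cell length plus 2; \<open>last\<close> is the mirror image, with the apex at index
    \<open>L\<close>.\<close>
  have first: "4 * D \<le> real M + 2" if "b' \<in> S" "a < b'" "b' \<le> b" "b' + 2 \<le> a + M"
    "t \<le> of_int (int b' - int a + 1)" for b'
  proof -
    have "{w 0, w (int b' - int a + 1)} \<in> E" using w_at[of b'] that w(2) by (auto simp: fan_edge_iff)
    then have "4 * D \<le> of_int (int b' - int a + 1 - 0) + 3"
      by (rule tight_cycle_chord[OF tight \<open>0 < D\<close>, rotated 2]) (use that t False in auto)
    then show ?thesis using that by simp
  qed
  have last: "4 * D \<le> real M + 2" if "a' \<in> S" "a \<le> a'" "a' < b" "b + 2 \<le> a' + M"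
    "of_int (int a' - int a + 1) \<le> t" for a'
  proof -
    have "{w (int a' - int a + 1), w (int L)} \<in> E" using w_at[of a'] that wL by (auto simp: fan_edge_iff)
    then have "4 * D \<le> of_int (int L - (int a' - int a + 1)) + 3"
      by (rule tight_cycle_chord[OF tight \<open>0 < D\<close>, rotated 2]) (use that t False b in auto)
    moreover have "int L - (int a' - int a + 1) + 3 \<le> int M + 2" using b that by linarith
    then have "of_int (int L - (int a' - int a + 1)) + 3 \<le> real M + 2" by linarith
    ultimately show ?thesis by linarith
  qed
  \<comment> \<open>The edge of the cycle that carries the centre; \<open>q = 0\<close> and
    \<open>q = L - 1\<close> are the two edges at the apex, which belong to no edge of the
    path.\<close>
  define q where "q = \<lfloor>t\<rfloor>"
  have q: "0 \<le> q" "q < int L" "of_int q \<le> t" "t < of_int q + 1" using t unfolding q_def by linarith+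
  have ab: "a < b" using b L by linarith
  consider "q = 0" | "q = int L - 1" | "1 \<le> q" "q \<le> int L - 2" using q by linarith
  then show ?thesis
  proof cases
    case 1
    obtain a' b' where "a' \<in> S" "b' \<in> S" "a \<le> a'" "a' \<le> a" "a < b'" "b' \<le> b" "b' + 2 \<le> a' + M"
      using cell[of a] ab by blast
    then show ?thesis using first[of b'] 1 q by simp
  next
    case 2
    obtain a' b' where ab': "a' \<in> S" "b' \<in> S" "a \<le> a'" "a' \<le> b - 1" "b - 1 < b'" "b' \<le> b" "b' + 2 \<le> a' + M"
      using cell[of "b - 1"] ab by (metis One_nat_def Suc_leI Suc_pred diff_less le_simps(2) less_nat_zero_code neq0_conv zero_less_one)
    then have "b' = b" "int a' - int a + 1 \<le> q" using 2 b ab by auto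
    moreover from this(2) have "of_int (int a' - int a + 1) \<le> t" using q by linarith
    ultimately show ?thesis using last[of a'] ab' ab by simp
  next
    case 3
    have x: "int (w q) = int a + q - 1" using w_eq[of q] 3 q by simp
    then have "a \<le> w q" "w q < b" using 3 b by linarith+
    then obtain a' b' where ab': "a' \<in> S" "b' \<in> S" "a \<le> a'" "a' \<le> w q" "w q < b'" "b' \<le> b" "b' + 2 \<le> a' + M"
      using cell[of "w q"] by blast
    have "int a' - int a + 1 \<le> q" "q + 1 \<le> int b' - int a + 1" using ab' x by linarith+
    then have at: "of_int (int a' - int a + 1) \<le> t" "t \<le> of_int (int b' - int a + 1)" using q by linarith+
    consider "a' = a" | "b' = b" | "a < a'" "b' < b" using ab' by linarith
    then show ?thesis
    proof cases
      case 1
      then show ?thesis using first[of b'] ab' at by simp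
    next
      case 2
      then show ?thesis using last[of a'] ab' at by simp
    next
      case 3
      \<comment> \<open>Together with \<open>5 <= g\<close> this gives the cell three path edges, as
        \<open>tight_cycle_detour\<close> demands.\<close>
      have gap: "a' + g \<le> b' + 2" using S_gap ab' by simp
      have "{w (int a' - int a + 1), w (int L)} \<in> E" "{w (int L), w (int b' - int a + 1)} \<in> E"
        using w_at[of a'] w_at[of b'] ab' 3 wL by (auto simp: fan_edge_iff)
      then have "4 * D \<le> of_int ((int b' - int a + 1) - (int a' - int a + 1)) + 4"
        by (rule tight_cycle_detour[OF tight \<open>0 < D\<close> at]) (use ab' 3 b gap g False in auto)
      then show ?thesis using ab' by simp
    qed
  qed
qed

lemma fan_tight_cycle:
  assumes tight: "tight_cycle D L w t" and "0 < D"
  shows "4 * D \<le> real M + 2"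
proof -
  have normal: "4 * D \<le> real M + 2" if asc: "ascending L v" and v: "tight_cycle D L v t" for v t
  proof -
    have cyc: "cyclic_walk E L v" using v by (simp add: tight_cycle_def)
    then have L: "0 < real L" using cyclic_walkD(1) by fastforce
    \<comment> \<open>Whole turns: a shift by a multiple of \<open>L\<close> leaves \<open>v\<close>
      unchanged and brings the centre into \<open>[0, L)\<close>.\<close>
    define k where "k = \<lfloor>t / real L\<rfloor> * int L"
    have "v (i + k) = v i" for i using cyclic_walk_add_mult[OF cyc] by (simp add: k_def)
    then have "tight_cycle D L v (t - of_int k)" using tight_cycle_shift[OF v, of k] by simp
    moreover have "of_int \<lfloor>t / real L\<rfloor> * real L \<le> t"
      using L by (simp add: pos_le_divide_eq[symmetric])
    moreover have "t < (of_int \<lfloor>t / real L\<rfloor> + 1) * real L"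
      using L by (simp add: pos_divide_less_eq[symmetric])
    ultimately show ?thesis
      using asc \<open>0 < D\<close> by (intro fan_ascending_tight_cycle[of L v D "t - of_int k"]) (auto simp: k_def algebra_simps)
  qed
  have "cyclic_walk E L w" using tight by (simp add: tight_cycle_def)
  then show ?thesis
  proof (cases rule: fan_cycle_ascending)
    case (1 k)
    then show ?thesis using normal tight_cycle_shift[OF tight] by blast
  next
    case (2 k)
    have "tight_cycle D L (\<lambda>i. w (- (i + (- k)))) (- t - of_int (- k))"
      by (rule tight_cycle_shift[OF tight_cycle_reflect[OF tight]])
    then show ?thesis using normal[OF 2] by (simp add: algebra_simps)
  qed
qed

lemma hyp_const_fan: "hyp_const {..<n} E \<le> (real M + 2) / 4"
proof (rule hyp_const_le)
  show "1 \<le> (real M + 2) / 4" using g gM by simp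
  show "\<not> tight_cycle D L w t" if "(real M + 2) / 4 < D" for D L w t
  proof
    assume "tight_cycle D L w t"
    then have "4 * D \<le> real M + 2" using that by (intro fan_tight_cycle) auto
    then show False using that by simp
  qed
qed

end

section \<open>From single graphs to the minimum, and the choice of spokes\<close>

lemma min_hyp_const_le:
  "E \<in> graph_class g c n \<Longrightarrow> min_hyp_const g c n \<le> hyp_const {..<n} E"
  unfolding min_hyp_const_def by (intro Min_le) (auto simp: finite_graph_class)

lemma graph_class_metric_graph: "E \<in> graph_class g c n \<Longrightarrow> metric_graph {..<n} E"
  by (simp add: graph_class_def metric_graph_def)

lemma girth_le_hyp_const:
  assumes "E \<in> graph_class g c n"
  shows "real g / 4 \<le> hyp_const {..<n} E"
proof -
  interpret metric_graph "{..<n}" E using assms by (rule graph_class_metric_graph)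
  have g: "g = Min (cycle_lengths E)" "cycle_lengths E \<noteq> {}"
    using assms by (auto simp: graph_class_def girth_def)
  then have "g \<in> cycle_lengths E" using Min_in[OF finite_cycle_lengths] by simp
  then obtain w where "cyclic_walk E g w"
    unfolding cycle_lengths_def using graph_cycle_cyclic_walk by blast
  then show ?thesis
    using g finite_cycle_lengths by (intro shortest_cycle_le_hyp_const) auto
qed

lemma girth_le_min_hyp_const:
  assumes "v_admissible g c n"
  shows "real g / 4 \<le> min_hyp_const g c n"
  unfolding min_hyp_const_def
  using assms girth_le_hyp_const by (subst Min_ge_iff) (auto simp: finite_graph_class v_admissible_def)

lemma min_hyp_const_le_circumference:
  assumes "v_admissible g c n" "4 \<le> c"
  shows "min_hyp_const g c n \<le> real c / 4"
proof -
  obtain E where E: "E \<in> graph_class g c n" using assms by (auto simp: v_admissible_def)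
  then interpret metric_graph "{..<n}" E by (rule graph_class_metric_graph)
  have "circumference E = c" using E by (simp add: graph_class_def)
  then show ?thesis using hyp_const_le_circumference min_hyp_const_le[OF E] assms(2) by simp
qed

text \<open>Spokes at 1, \<open>g - 1\<close> and \<open>c - 1\<close> give cells of lengths
  \<open>g\<close> and \<open>c + 2 - g\<close>; by \<open>2 * g <= c\<close> the second is the
  longer one.\<close>

lemma min_hyp_const_two_cells:
  assumes "5 \<le> g" "2 * g \<le> c" "c \<le> n"
  shows "min_hyp_const g c n \<le> (real c - real g + 4) / 4"
proof -
  interpret fan_graph g "c + 2 - g" c n "{1, g - 1, c - 1}"
  proof
    show "\<exists>a\<in>{1, g - 1, c - 1}. \<exists>b\<in>{1, g - 1, c - 1}. a \<le> x \<and> x < b \<and> b + 2 \<le> a + (c + 2 - g)"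
      if "1 \<le> x" "x + 1 < c" for x
      using that assms by (cases "x < g - 1") auto
  qed (use assms in auto)
  show ?thesis using hyp_const_fan min_hyp_const_le[OF fan_in_graph_class] assms
    by (simp add: of_nat_diff)
qed

text \<open>A cell of length \<open>g\<close> uses \<open>h = g - 2\<close> edges of the path, which
  has \<open>c - 2\<close> edges in all. This leaves \<open>K\<close> cells of length
  \<open>g\<close>, then one with \<open>h + r div 2\<close> and one with
  \<open>h + (r + 1) div 2\<close> path edges, separated by the spoke at \<open>mid\<close>.
  \<open>1 <= K\<close> secures a cell of length exactly \<open>g\<close>.\<close>

lemma min_hyp_const_many_cells:
  assumes "5 \<le> g" "c \<le> n" and K: "1 \<le> K" "c = (K + 2) * (g - 2) + r + 2" "r < g - 2"
  shows "min_hyp_const g c n \<le> (real (g + (r + 1) div 2) + 2) / 4"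
proof -
  define h where "h = g - 2"
  define mid where "mid = 1 + (K + 1) * h + r div 2"
  define S where "S = {1 + i * h | i. i \<le> K} \<union> {mid, c - 1}"
  have h: "g = h + 2" "3 \<le> h" "r < h" using assms by (auto simp: h_def)
  have "c = (K + 2) * h + r + 2" using K by (simp add: h_def)
  moreover have "r div 2 + (r + 1) div 2 = r" by presburger
  ultimately have c: "c - 1 = mid + h + (r + 1) div 2" by (simp add: mid_def add_mult_distrib)
  have mid: "mid = 1 + K * h + h + r div 2" by (simp add: mid_def)
  \<comment> \<open>From spoke \<open>i\<close> to \<open>mid\<close> there are \<open>K - i\<close>
    cells of length \<open>g\<close> and one that is at least as long.\<close>
  have S_le: "1 + i * h + (K - i) * h + h \<le> mid" if "i \<le> K" for i
    using that unfolding mid by (simp add: add_mult_distrib[symmetric])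
  have mid_less: "1 \<le> mid" "mid < c - 1" using c h by (auto simp: mid)
  have S_bound: "1 \<le> a \<and> a < c" if a: "a \<in> S" for a
  proof -
    consider i where "i \<le> K" "a = 1 + i * h" | "a = mid" | "a = c - 1" using a unfolding S_def by auto
    then show ?thesis
    proof cases
      case (1 i)
      then show ?thesis using S_le[of i] mid_less by simp
    qed (use mid_less in auto)
  qed
  interpret fan_graph g "g + (r + 1) div 2" c n S
  proof
    show "1 \<in> S" "c - 1 \<in> S" by (auto simp: S_def intro!: exI[of _ "0::nat"])
    have "1 + 1 * h \<in> S" using K unfolding S_def by blast
    then show "\<exists>a\<in>S. a + (g - 2) \<in> S" using \<open>1 \<in> S\<close> h by (intro bexI[of _ 1]) auto
    show "1 \<le> a \<and> a < c" if "a \<in> S" for a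
      using that by (rule S_bound)
    show "a + g \<le> b + 2" if ab: "a \<in> S" "b \<in> S" "a < b" for a b
    proof -
      consider i j where "a = 1 + i * h" "b = 1 + j * h" | i where "i \<le> K" "a = 1 + i * h" "mid \<le> b"
        | "a = mid" "b = c - 1"
      proof -
        have "b \<le> c - 1" using S_bound[OF ab(2)] by linarith
        then have "a \<noteq> c - 1" using ab by simp
        then consider i where "i \<le> K" "a = 1 + i * h" | "a = mid" using ab(1) unfolding S_def by auto
        then show thesis
        proof cases
          case (1 i)
          consider j where "b = 1 + j * h" | "b = mid" | "b = c - 1" using ab(2) unfolding S_def by auto
          then show thesis using that(1)[of i] that(2)[of i] 1 mid_less by cases auto
        next
          case 2
          have "b \<noteq> 1 + j * h" if "j \<le> K" for j using S_le[OF that] ab(3) 2 by simp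
          then have "b = c - 1" using ab(2,3) 2 unfolding S_def by blast
          then show thesis using that(3) 2 by simp
        qed
      qed
      then show ?thesis
      proof cases
        case 1
        then have "i < j" using that h by simp
        then have "(i + 1) * h \<le> j * h" by (intro mult_le_mono1) simp
        then show ?thesis using 1 h by simp
      next
        case 2
        then show ?thesis using S_le[of i] h by simp
      next
        case 3
        then show ?thesis using c h by simp
      qed
    qed
    show "\<exists>a\<in>S. \<exists>b\<in>S. a \<le> x \<and> x < b \<and> b + 2 \<le> a + (g + (r + 1) div 2)" if "1 \<le> x" "x + 1 < c" for x
    proof -
      consider "x < 1 + K * h" | "1 + K * h \<le> x" "x < mid" | "mid \<le> x" by linarith
      then show ?thesis
      proof cases
        case 1
        \<comment> \<open>Number of the cell over \<open>x\<close> among the first \<open>K\<close>,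
          all of which have \<open>h\<close> path edges.\<close>
        define i where "i = (x - 1) div h"
        have "x - 1 < K * h" using 1 that by simp
        then have "i < K" unfolding i_def using h by (simp add: div_less_iff_less_mult)
        moreover have "i * h \<le> x - 1" "x - 1 < (i + 1) * h"
          unfolding i_def using h by (auto simp: dividend_less_div_times less_eq_div_iff_mult_less_eq[symmetric])
        moreover from \<open>i < K\<close> have "1 + i * h \<in> S" "1 + (i + 1) * h \<in> S" unfolding S_def by fastforce+
        ultimately show ?thesis using h that
          by (intro bexI[of _ "1 + i * h"] bexI[of _ "1 + (i + 1) * h"]) auto
      next
        case 2
        then show ?thesis using h mid unfolding S_def
          by (intro bexI[of _ "1 + K * h"] bexI[of _ mid]) auto
      next
        case 3
        then show ?thesis using h that c unfolding S_def
          by (intro bexI[of _ mid] bexI[of _ "c - 1"]) auto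
      qed
    qed
  qed (use assms in auto)
  show ?thesis using hyp_const_fan min_hyp_const_le[OF fan_in_graph_class] by simp
qed

theorem theorem3p11:
  fixes g c n :: nat
  assumes "v_admissible g c n"
    and "5 \<le> g" and "g \<le> c" and "c \<le> n"
  shows "(c < 3 * g - 4 \<longrightarrow>
            real g / 4 \<le> min_hyp_const g c n \<and>
            min_hyp_const g c n \<le> (2 * real g - 1) / 4) \<and>
         (c = 3 * g - 4 \<longrightarrow>
            (even g \<longrightarrow> real g / 4 \<le> min_hyp_const g c n \<and>
                       min_hyp_const g c n \<le> (real g + 2) / 4) \<and>
            (odd g \<longrightarrow> real g / 4 \<le> min_hyp_const g c n \<and>
                      min_hyp_const g c n \<le> (real g + 3) / 4)) \<and>
         (c > 3 * g - 4 \<longrightarrow>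
            (even g \<longrightarrow> real g / 4 \<le> min_hyp_const g c n \<and>
                       min_hyp_const g c n \<le> (3 * real g + 5) / 8) \<and>
            (odd g \<longrightarrow> real g / 4 \<le> min_hyp_const g c n \<and>
                      min_hyp_const g c n \<le> (3 * real g + 7) / 8))"
proof -
  have lower: "real g / 4 \<le> min_hyp_const g c n"
    using assms(1) by (rule girth_le_min_hyp_const)
  \<comment> \<open>The two branches meet the same bound at their extremes:
    \<open>c = 2 * g - 1\<close> in the estimate valid for every graph, and
    \<open>c = 3 * g - 5\<close> for the fan with two cells.\<close>
  have small: "min_hyp_const g c n \<le> (2 * real g - 1) / 4" if "c < 3 * g - 4"
  proof (cases "c < 2 * g")
    case True
    have "min_hyp_const g c n \<le> real c / 4"
      using assms by (intro min_hyp_const_le_circumference) auto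
    then show ?thesis using True by simp
  next
    case False
    then have "min_hyp_const g c n \<le> (real c - real g + 4) / 4"
      using assms by (intro min_hyp_const_two_cells) auto
    then show ?thesis using that by simp
  qed
  have large: "min_hyp_const g c n \<le> (real (g + (r + 1) div 2) + 2) / 4"
    if "3 * g - 4 \<le> c" "r = (c - 2) mod (g - 2)" for r
  proof -
    define k where "k = (c - 2) div (g - 2)"
    \<comment> \<open>\<open>3 * g - 4\<close> is the circumference of the fan with three cells of
      length \<open>g\<close>; from there on \<open>K = k - 2\<close> is at least 1.\<close>
    have "3 * (g - 2) \<le> c - 2" using that assms by simp
    then have k: "3 \<le> k" using assms by (simp add: k_def less_eq_div_iff_mult_less_eq)
    have "c - 2 = k * (g - 2) + r" using div_mult_mod_eq[of "c - 2" "g - 2"] that by (simp add: k_def)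
    moreover have "k - 2 + 2 = k" "c = c - 2 + 2" using k assms by auto
    ultimately have "c = (k - 2 + 2) * (g - 2) + r + 2" by metis
    then show ?thesis using assms k that
      by (intro min_hyp_const_many_cells[of g c n "k - 2"]) auto
  qed
  have "min_hyp_const g c n \<le> (real g + 2) / 4" if "c = 3 * g - 4"
  proof -
    have "c - 2 = 3 * (g - 2)" using that assms by simp
    then have "(c - 2) mod (g - 2) = 0" by simp
    then show ?thesis using large[of 0] that by simp
  qed
  moreover have "min_hyp_const g c n \<le> (3 * real g + 5) / 8" if "c > 3 * g - 4"
  proof -
    define r where "r = (c - 2) mod (g - 2)"
    have "r < g - 2" unfolding r_def using assms by simp
    \<comment> \<open>As \<open>r <= g - 3\<close>, the longest cell exceeds \<open>g\<close> by at
      most half of \<open>g - 2\<close>. The bound obtained does not depend on the parity of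
      \<open>g\<close>, and the one claimed for odd \<open>g\<close> is weaker.\<close>
    then have "2 * ((r + 1) div 2) \<le> g - 2" by simp
    then have "2 * real ((r + 1) div 2) \<le> real g" by linarith
    then show ?thesis using large[of r] that r_def by simp
  qed
  ultimately show ?thesis using lower small by auto
qed

end
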